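(* Let $S\subseteq\mathbb{N}$ be nonempty and such that the $S$-gap shift $X_S$ is non-sofic. Then its star-studded version $X_S^{( * )}$ is a non-sofic synchronized subshift which is topologically direct prime and which admits a reversible cellular automaton with all directions sensitive.
   Context: **Subshifts.** For a finite nonempty alphabet $A$, $A^{\mathbb{Z}}$ has the product topology and $\sigma(x)[i]=x[i+1]$. A subshift is a nonempty closed $X\subseteq A^{\mathbb{Z}}$ with $\sigma(X)=X$. $L(X)$ is the set of finite words (including the empty word) occurring in elements of $X$. A sliding block code $F:X\to Y$ between subshifts is a map such that for some integers $m\le a$ and some $f$, $F(x)[i]=f(x[i+m],\dots,x[i+a])$ for all $x\in X$, $i\in\mathbb{Z}$; a conjugacy is a bijective sliding block code. For subshifts $Y\subseteq A^{\mathbb{Z}}$, $Z\subseteq B^{\mathbb{Z}}$, the product $Y\times Z$ is regarded as a subshift of $(A\times B)^{\mathbb{Z}}$. A subshift is trivial if it has exactly one element. $X$ is (topologically) direct prime if whenever $X$ is conjugate to $Y\times Z$ for subshifts $Y,Z$, then $Y$ or $Z$ is trivial. **Soficity, synchronization.** For $x\in X$ let $x^+=x[0]x[1]\cdots$, $x^-=\cdots x[-2]x[-1]$, $X^+=\{x^+:x\in X\}$, $X^-=\{x^-:x\in X\}$. For $x^-\in X^-$, $\omega_X(x^-)=\{y^+\in X^+ : x^-y^+\in X\}$; for $w\in L(X)$, $\omega_X(w)=\{x^+\in X^+ : wx^+\in X^+\}$. $X$ is sofic if $\{\omega_X(x^-):x\in X\}$ is finite. $X$ is transitive if for all $u,v\in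 L(X)$ there is $w\in L(X)$ with $uwv\in L(X)$. A word $w\in L(X)$ is synchronizing if every $x^-\in X^-$ having $w$ as a suffix satisfies $\omega_X(x^-)=\omega_X(w)$. $X$ is synchronized if it is transitive and has a synchronizing word. **$S$-gap shifts.** For nonempty $S\subseteq\mathbb{N}=\{0,1,2,\dots\}$, $X_S\subseteq\{0,1\}^{\mathbb{Z}}$ is the subshift whose language consists of all subwords of elements of $\{01^n : n\in S\}^*$. **Star-studded version.** For a subshift $X\subseteq A^{\mathbb{Z}}$ with set of forbidden words $\mathcal{F}$ (i.e. $X$ is the set of $x\in A^{\mathbb{Z}}$ in which no word of $\mathcal{F}$ occurs) and a new symbol $*\notin A$, let $h:(A\cup\{*\})^*\to A^*$ be the monoid morphism with $h( * )=\epsilon$ (the empty word) and $h(a)=a$ for $a\in A$. Then $X^{( * )}\subseteq(A\cup\{*\})^{\mathbb{Z}}$ is the subshift with forbidden words $\{**\}\cup\{w\in(A\cup\{*\})^* : h(w)\in\mathcal{F}\}$; equivalently, it consists of all configurations obtained from some $x\in X$ by interleaving symbols $*$ so that no two consecutive $*$ occur. **Cellular automata and sensitivity.** A cellular automaton (CA) on $X$ is a sliding block code $F:X\to X$; it is reversible (an RCA) if it is bijective. It is a radius-$r$ CA ($r\ge0$) if one can take $m=-r$, $a=r$ above. A word $w\in L(X)$ is a blocking word for a radius-$r$ CA $F$ if there are integers $e$ with $|w|\ge e\ge r+1$ and $p\in[0,|w|-e]$ such that for all $x,y\in X$ in which $w$ occurs at position $0$ and all $n\in\mathbb{N}$, $F^n(x)[p,p+e-1]=F^n(y)[p,p+e-1]$.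 A CA on a transitive subshift is almost equicontinuous if it has a blocking word, and sensitive otherwise. For coprime integers $p,q$ with $q>0$, $p/q$ is a sensitive direction of $F$ if $\sigma^p\circ F^q$ is sensitive. $F$ has all directions sensitive if every such $p/q$ is a sensitive direction. *)

theory Defs
  imports "HOL-Analysis.Analysis" "HOL-Library.Sublist"
begin

section \<open>Configurations, words and subshifts\<close>

text \<open>Configurations over an alphabet \<open>A\<close> are functions on the integers with values in the finite
  set \<open>A\<close>. The integer power of the shift map is \<open>shift p\<close>; the shift map itself is \<open>shift 1\<close>.\<close>

definition shift :: "int \<Rightarrow> (int \<Rightarrow> 'a) \<Rightarrow> int \<Rightarrow> 'a" where
  "shift p x = (\<lambda>i. x (i + p))"

definition word_at :: "(int \<Rightarrow> 'a) \<Rightarrow> int \<Rightarrow> nat \<Rightarrow> 'a list" where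
  "word_at x i n = map (\<lambda>k. x (i + int k)) [0..<n]"

definition language :: "(int \<Rightarrow> 'a) set \<Rightarrow> 'a list set" where
  "language X = {word_at x i n | x i n. x \<in> X}"

definition full_shift :: "'a set \<Rightarrow> (int \<Rightarrow> 'a) topology" where
  "full_shift A = product_topology (\<lambda>_. discrete_topology A) UNIV"

definition subshift :: "'a set \<Rightarrow> (int \<Rightarrow> 'a) set \<Rightarrow> bool" where
  "subshift A X \<longleftrightarrow> finite A \<and> X \<noteq> {} \<and> closedin (full_shift A) X \<and> shift 1 ` X = X"

definition avoiding :: "'a set \<Rightarrow> 'a list set \<Rightarrow> (int \<Rightarrow> 'a) set" where
  "avoiding A \<F> = {x. range x \<subseteq> A \<and> (\<forall>w\<in>\<F>. \<forall>i. word_at x i (length w) \<noteq> w)}"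

section \<open>Sliding block codes and direct primeness\<close>

definition sliding_block_code ::
  "(int \<Rightarrow> 'a) set \<Rightarrow> (int \<Rightarrow> 'b) set \<Rightarrow> ((int \<Rightarrow> 'a) \<Rightarrow> int \<Rightarrow> 'b) \<Rightarrow> bool" where
  "sliding_block_code X Y F \<longleftrightarrow> F ` X \<subseteq> Y \<and>
     (\<exists>m a f. m \<le> a \<and> (\<forall>x\<in>X. \<forall>i. F x i = f (word_at x (i + m) (nat (a - m + 1)))))"

definition conjugate :: "(int \<Rightarrow> 'a) set \<Rightarrow> (int \<Rightarrow> 'b) set \<Rightarrow> bool" where
  "conjugate X Y \<longleftrightarrow> (\<exists>F. sliding_block_code X Y F \<and> bij_betw F X Y)"

definition product_shift :: "(int \<Rightarrow> 'a) set \<Rightarrow> (int \<Rightarrow> 'b) set \<Rightarrow> (int \<Rightarrow> 'a \<times> 'b) set" where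
  "product_shift Y Z = {\<lambda>i. (y i, z i) | y z. y \<in> Y \<and> z \<in> Z}"

text \<open>The alphabets of the two factors range over finite sets of natural numbers, since a definition
  cannot quantify over types. Every finite alphabet can be renamed to such a set;
  see \<open>direct_primeD\<close> below, which allows arbitrary alphabets.\<close>

definition direct_prime :: "(int \<Rightarrow> 'a) set \<Rightarrow> bool" where
  "direct_prime X \<longleftrightarrow>
     (\<forall>(B :: nat set) (C :: nat set) Y Z.
        subshift B Y \<longrightarrow> subshift C Z \<longrightarrow> conjugate X (product_shift Y Z) \<longrightarrow>
        is_singleton Y \<or> is_singleton Z)"

section \<open>Soficity and synchronization\<close>

text \<open>A left ray is indexed from right to left: \<open>left_ray x n\<close> is the symbol of \<open>x\<close> at \<open>-1 - n\<close>.\<close>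

definition right_ray :: "(int \<Rightarrow> 'a) \<Rightarrow> nat \<Rightarrow> 'a" where
  "right_ray x = (\<lambda>n. x (int n))"

definition left_ray :: "(int \<Rightarrow> 'a) \<Rightarrow> nat \<Rightarrow> 'a" where
  "left_ray x = (\<lambda>n. x (- 1 - int n))"

definition join_rays :: "(nat \<Rightarrow> 'a) \<Rightarrow> (nat \<Rightarrow> 'a) \<Rightarrow> int \<Rightarrow> 'a" where
  "join_rays l r = (\<lambda>i. if i \<ge> 0 then r (nat i) else l (nat (- 1 - i)))"

definition prepend :: "'a list \<Rightarrow> (nat \<Rightarrow> 'a) \<Rightarrow> nat \<Rightarrow> 'a" where
  "prepend w r = (\<lambda>n. if n < length w then w ! n else r (n - length w))"

definition followers_ray :: "(int \<Rightarrow> 'a) set \<Rightarrow> (nat \<Rightarrow> 'a) \<Rightarrow> (nat \<Rightarrow> 'a) set" where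
  "followers_ray X l = {r \<in> right_ray ` X. join_rays l r \<in> X}"

definition followers_word :: "(int \<Rightarrow> 'a) set \<Rightarrow> 'a list \<Rightarrow> (nat \<Rightarrow> 'a) set" where
  "followers_word X w = {r \<in> right_ray ` X. prepend w r \<in> right_ray ` X}"

definition sofic :: "(int \<Rightarrow> 'a) set \<Rightarrow> bool" where
  "sofic X \<longleftrightarrow> finite (followers_ray X ` left_ray ` X)"

definition transitive :: "(int \<Rightarrow> 'a) set \<Rightarrow> bool" where
  "transitive X \<longleftrightarrow> (\<forall>u\<in>language X. \<forall>v\<in>language X. \<exists>w\<in>language X. u @ w @ v \<in> language X)"

definition synchronizing :: "(int \<Rightarrow> 'a) set \<Rightarrow> 'a list \<Rightarrow> bool" where
  "synchronizing X w \<longleftrightarrow> w \<in> language X \<and>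
     (\<forall>l\<in>left_ray ` X. (\<forall>k<length w. l k = rev w ! k) \<longrightarrow> followers_ray X l = followers_word X w)"

definition synchronized :: "(int \<Rightarrow> 'a) set \<Rightarrow> bool" where
  "synchronized X \<longleftrightarrow> transitive X \<and> (\<exists>w. synchronizing X w)"

section \<open>Gap shifts and star-studded versions\<close>

definition gap_words :: "nat set \<Rightarrow> nat list set" where
  "gap_words S = {w. \<exists>ns. set ns \<subseteq> S \<and> sublist w (concat (map (\<lambda>n. 0 # replicate n 1) ns))}"

text \<open>A subshift is determined by its language, as the set of all configurations all of whose
  finite words belong to it; \<open>language_gap_shift\<close> below confirms the language.\<close>

definition gap_shift :: "nat set \<Rightarrow> (int \<Rightarrow> nat) set" where
  "gap_shift S = {x. \<forall>i n. word_at x i n \<in> gap_words S}"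

text \<open>The new symbol is \<open>None\<close>, and \<open>List.map_filter id\<close> is the morphism erasing it.\<close>

definition star_alphabet :: "'a set \<Rightarrow> 'a option set" where
  "star_alphabet A = insert None (Some ` A)"

definition star_avoiding :: "'a set \<Rightarrow> 'a list set \<Rightarrow> (int \<Rightarrow> 'a option) set" where
  "star_avoiding A \<F> = avoiding (star_alphabet A)
     (insert [None, None] {w \<in> lists (star_alphabet A). List.map_filter id w \<in> \<F>})"

text \<open>The set of all words over \<open>A\<close> outside the language serves as the set of forbidden words
  of a subshift; by \<open>star_avoiding_eq_star_studded\<close> below any other choice gives the same result.\<close>

definition star_studded :: "'a set \<Rightarrow> (int \<Rightarrow> 'a) set \<Rightarrow> (int \<Rightarrow> 'a option) set" where
  "star_studded A X = star_avoiding A (lists A - language X)"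

section \<open>Cellular automata and sensitivity\<close>

definition cellular_automaton ::
  "(int \<Rightarrow> 'a) set \<Rightarrow> ((int \<Rightarrow> 'a) \<Rightarrow> int \<Rightarrow> 'a) \<Rightarrow> bool" where
  "cellular_automaton X F \<longleftrightarrow> sliding_block_code X X F"

definition reversible_ca ::
  "(int \<Rightarrow> 'a) set \<Rightarrow> ((int \<Rightarrow> 'a) \<Rightarrow> int \<Rightarrow> 'a) \<Rightarrow> bool" where
  "reversible_ca X F \<longleftrightarrow> cellular_automaton X F \<and> bij_betw F X X"

definition radius_ca ::
  "nat \<Rightarrow> (int \<Rightarrow> 'a) set \<Rightarrow> ((int \<Rightarrow> 'a) \<Rightarrow> int \<Rightarrow> 'a) \<Rightarrow> bool" where
  "radius_ca r X F \<longleftrightarrow> F ` X \<subseteq> X \<and>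
     (\<exists>f. \<forall>x\<in>X. \<forall>i. F x i = f (word_at x (i - int r) (2 * r + 1)))"

definition blocking_word ::
  "nat \<Rightarrow> (int \<Rightarrow> 'a) set \<Rightarrow> ((int \<Rightarrow> 'a) \<Rightarrow> int \<Rightarrow> 'a) \<Rightarrow> 'a list \<Rightarrow> bool" where
  "blocking_word r X F w \<longleftrightarrow> w \<in> language X \<and>
     (\<exists>e p. r + 1 \<le> e \<and> e \<le> length w \<and> p \<le> length w - e \<and>
        (\<forall>x\<in>X. \<forall>y\<in>X. word_at x 0 (length w) = w \<longrightarrow> word_at y 0 (length w) = w \<longrightarrow>
           (\<forall>n. word_at ((F ^^ n) x) (int p) e = word_at ((F ^^ n) y) (int p) e)))"

text \<open>A cellular automaton has every sufficiently large radius; it suffices that it has a blocking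
  word with respect to one of them. On a transitive subshift the choice is immaterial: if \<open>w\<close> is
  blocking, so are words \<open>w @ u @ w\<close>, with arbitrarily long fixed part.\<close>

definition almost_equicontinuous ::
  "(int \<Rightarrow> 'a) set \<Rightarrow> ((int \<Rightarrow> 'a) \<Rightarrow> int \<Rightarrow> 'a) \<Rightarrow> bool" where
  "almost_equicontinuous X F \<longleftrightarrow> (\<exists>r w. radius_ca r X F \<and> blocking_word r X F w)"

definition sensitive :: "(int \<Rightarrow> 'a) set \<Rightarrow> ((int \<Rightarrow> 'a) \<Rightarrow> int \<Rightarrow> 'a) \<Rightarrow> bool" where
  "sensitive X F \<longleftrightarrow> \<not> almost_equicontinuous X F"

definition all_directions_sensitive ::
  "(int \<Rightarrow> 'a) set \<Rightarrow> ((int \<Rightarrow> 'a) \<Rightarrow> int \<Rightarrow> 'a) \<Rightarrow> bool" where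
  "all_directions_sensitive X F \<longleftrightarrow>
     (\<forall>(p :: int) (q :: nat). q > 0 \<longrightarrow> coprime p (int q) \<longrightarrow> sensitive X (shift p \<circ> (F ^^ q)))"

section \<open>Independence of the encoding\<close>

lemma word_at_0 [simp]: "word_at x i 0 = []"
  by (simp add: word_at_def)

lemma length_word_at [simp]: "length (word_at x i n) = n"
  by (simp add: word_at_def)

lemma word_at_Suc: "word_at x i (Suc n) = x i # word_at x (i + 1) n"
  by (auto intro!: nth_equalityI simp: word_at_def nth_Cons' algebra_simps simp del: upt_Suc)

lemma word_at_add: "word_at x i (m + n) = word_at x i m @ word_at x (i + int m) n"
  by (auto intro!: nth_equalityI simp: word_at_def nth_append algebra_simps of_nat_diff)

lemma word_at_compose: "word_at (\<lambda>i. g (x i)) i n = map g (word_at x i n)"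
  by (simp add: word_at_def)

lemma word_at_in_language: "x \<in> X \<Longrightarrow> word_at x i n \<in> language X"
  unfolding language_def by blast

lemma conjugate_rename:
  assumes "conjugate X Y" "inj_on (\<lambda>x i. g (x i)) Y"
  shows "conjugate X ((\<lambda>x i. g (x i)) ` Y)"
proof -
  from assms(1) obtain F m a f where F: "F ` X \<subseteq> Y" "m \<le> a"
     "\<And>x i. x \<in> X \<Longrightarrow> F x i = f (word_at x (i + m) (nat (a - m + 1)))" and b: "bij_betw F X Y"
    unfolding conjugate_def sliding_block_code_def by metis
  let ?G = "(\<lambda>x i. g (x i)) \<circ> F"
  have "bij_betw ?G X ((\<lambda>x i. g (x i)) ` Y)"
    using b assms(2) by (meson bij_betw_trans inj_on_imp_bij_betw)
  moreover have "sliding_block_code X ((\<lambda>x i. g (x i)) ` Y) ?G"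
    unfolding sliding_block_code_def
  proof (intro conjI exI)
    show "?G ` X \<subseteq> (\<lambda>x i. g (x i)) ` Y" using F(1) by auto
    show "m \<le> a" by fact
    show "\<forall>x\<in>X. \<forall>i. ?G x i = (g \<circ> f) (word_at x (i + m) (nat (a - m + 1)))"
      using F(3) by simp
  qed
  ultimately show ?thesis unfolding conjugate_def by blast
qed

lemma subshift_range: "subshift A X \<Longrightarrow> x \<in> X \<Longrightarrow> x i \<in> A"
  by (auto simp: subshift_def full_shift_def PiE_iff dest!: closedin_subset)

lemma subshift_rename:
  assumes "subshift A X" "inj_on g A"
  shows "subshift (g ` A) ((\<lambda>x i. g (x i)) ` X)"
proof -
  let ?k = "inv_into A g"
  let ?K = "\<lambda>x i. ?k (x i)"
  note kg = inv_into_f_f[OF assms(2)]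
  have eq: "(\<lambda>x i. g (x i)) ` X = {y \<in> topspace (full_shift (g ` A)). ?K y \<in> X}"
  proof (intro equalityI subsetI)
    fix y assume "y \<in> (\<lambda>x i. g (x i)) ` X"
    then obtain x where x: "x \<in> X" "y = (\<lambda>i. g (x i))" by auto
    then have "?K y = x" using kg subshift_range[OF assms(1)] by auto
    with x show "y \<in> {y \<in> topspace (full_shift (g ` A)). ?K y \<in> X}"
      using subshift_range[OF assms(1)] by (auto simp: full_shift_def)
  next
    fix y assume "y \<in> {y \<in> topspace (full_shift (g ` A)). ?K y \<in> X}"
    then have y: "\<And>i. y i \<in> g ` A" "?K y \<in> X" by (auto simp: full_shift_def)
    have "y = (\<lambda>i. g (?K y i))" using y(1) by (auto simp: f_inv_into_f)
    then show "y \<in> (\<lambda>x i. g (x i)) ` X" by (rule image_eqI[where x = "?K y"]) (rule y(2))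
  qed
  have "continuous_map (full_shift (g ` A)) (full_shift A) ?K"
    unfolding full_shift_def continuous_map_componentwise_UNIV
  proof
    fix i :: int
    have "continuous_map (product_topology (\<lambda>_. discrete_topology (g ` A)) UNIV)
        (discrete_topology A) (?k \<circ> (\<lambda>x. x i))"
    proof (rule continuous_map_compose)
      show "continuous_map (product_topology (\<lambda>_. discrete_topology (g ` A)) UNIV)
        (discrete_topology (g ` A)) (\<lambda>x. x i)"
        by (rule continuous_map_product_projection) simp
      show "continuous_map (discrete_topology (g ` A)) (discrete_topology A) ?k"
        using kg by auto
    qed
    then show "continuous_map (product_topology (\<lambda>_. discrete_topology (g ` A)) UNIV)
        (discrete_topology A) (\<lambda>x. ?k (x i))" by (simp add: o_def)
  qed
  then have cl: "closedin (full_shift (g ` A)) ((\<lambda>x i. g (x i)) ` X)"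
    unfolding eq using assms(1) closedin_continuous_map_preimage
    unfolding subshift_def by blast
  have "shift 1 ` (\<lambda>x i. g (x i)) ` X = (\<lambda>x i. g (x i)) ` shift 1 ` X"
    by (simp add: image_image shift_def)
  also have "\<dots> = (\<lambda>x i. g (x i)) ` X" using assms(1) by (simp add: subshift_def)
  finally show ?thesis using assms(1) cl by (simp add: subshift_def)
qed

lemma inj_on_rename:
  assumes "subshift A X" "inj_on g A"
  shows "inj_on (\<lambda>x i. g (x i)) X"
proof (rule inj_onI, rule ext)
  fix x y i assume "x \<in> X" "y \<in> X" "(\<lambda>i. g (x i)) = (\<lambda>i. g (y i))"
  then show "x i = y i"
    using inj_onD[OF assms(2), of "x i" "y i"] subshift_range[OF assms(1)] by metis
qed

theorem direct_primeD:
  assumes X: "direct_prime X" and Y: "subshift B Y" and Z: "subshift C Z"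
    and c: "conjugate X (product_shift Y Z)"
  shows "is_singleton Y \<or> is_singleton Z"
proof -
  obtain g h :: "_ \<Rightarrow> nat" where g: "inj_on g B" and h: "inj_on h C"
    using Y Z unfolding subshift_def by (metis finite_imp_inj_to_nat_seg)
  let ?Y = "(\<lambda>x i. g (x i)) ` Y" and ?Z = "(\<lambda>x i. h (x i)) ` Z"
  have eq: "product_shift ?Y ?Z = (\<lambda>x i. map_prod g h (x i)) ` product_shift Y Z"
  proof (intro equalityI subsetI)
    fix v assume "v \<in> product_shift ?Y ?Z"
    then obtain y z where *: "y \<in> Y" "z \<in> Z" "v = (\<lambda>i. (g (y i), h (z i)))"
      unfolding product_shift_def by blast
    have "(\<lambda>i. (y i, z i)) \<in> product_shift Y Z" using * unfolding product_shift_def by blast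
    then show "v \<in> (\<lambda>x i. map_prod g h (x i)) ` product_shift Y Z"
      by (rule image_eqI[where x = "\<lambda>i. (y i, z i)", rotated]) (simp add: *)
  next
    fix v assume "v \<in> (\<lambda>x i. map_prod g h (x i)) ` product_shift Y Z"
    then obtain y z where "y \<in> Y" "z \<in> Z" "v = (\<lambda>i. (g (y i), h (z i)))"
      unfolding product_shift_def by auto
    moreover from this have "(\<lambda>i. g (y i)) \<in> ?Y" "(\<lambda>i. h (z i)) \<in> ?Z" by auto
    ultimately show "v \<in> product_shift ?Y ?Z"
      unfolding product_shift_def mem_Collect_eq by (intro exI conjI)
  qed
  have "inj_on (\<lambda>x i. map_prod g h (x i)) (product_shift Y Z)"
  proof (rule inj_onI)
    fix u v assume "u \<in> product_shift Y Z" "v \<in> product_shift Y Z"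
      and e: "(\<lambda>i. map_prod g h (u i)) = (\<lambda>i. map_prod g h (v i))"
    then obtain y z y' z' where *: "u = (\<lambda>i. (y i, z i))" "v = (\<lambda>i. (y' i, z' i))"
      "y \<in> Y" "z \<in> Z" "y' \<in> Y" "z' \<in> Z" unfolding product_shift_def by blast
    have "(\<lambda>i. g (y i)) = (\<lambda>i. g (y' i))" "(\<lambda>i. h (z i)) = (\<lambda>i. h (z' i))"
      using e * by (auto simp: fun_eq_iff)
    then have "y = y'" "z = z'"
      using * inj_onD[OF inj_on_rename[OF Y g]] inj_onD[OF inj_on_rename[OF Z h]] by blast+
    then show "u = v" using * by simp
  qed
  then have "conjugate X (product_shift ?Y ?Z)"
    unfolding eq by (rule conjugate_rename[OF c])
  then have "is_singleton ?Y \<or> is_singleton ?Z"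
    using X subshift_rename[OF Y g] subshift_rename[OF Z h] unfolding direct_prime_def by blast
  then show ?thesis
    using card_image[OF inj_on_rename[OF Y g]] card_image[OF inj_on_rename[OF Z h]]
    by (simp add: is_singleton_altdef)
qed

theorem language_gap_shift:
  assumes "S \<noteq> {}"
  shows "language (gap_shift S) = gap_words S"
proof
  show "language (gap_shift S) \<subseteq> gap_words S"
    by (auto simp: language_def gap_shift_def)
  show "gap_words S \<subseteq> language (gap_shift S)"
  proof
    fix w assume "w \<in> gap_words S"
    let ?c = "\<lambda>ns. concat (map (\<lambda>n::nat. (0::nat) # replicate n 1) ns)"
    obtain ns where ns: "set ns \<subseteq> S" "sublist w (?c ns)"
      using \<open>w \<in> gap_words S\<close> by (auto simp: gap_words_def)
    obtain s where s: "s \<in> S" using assms by auto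
    define u where "u = ?c (ns @ [s])"
    have u0: "length u > 0" by (simp add: u_def)
    define x where "x = (\<lambda>i::int. u ! nat (i mod int (length u)))"
    have per: "word_at x (int (length u) * j) (length u * k) = concat (replicate k u)" for j k
    proof (induction k arbitrary: j)
      case (Suc k)
      have "word_at x (int (length u) * j) (length u) = u"
        by (rule nth_equalityI) (auto simp: word_at_def x_def)
      moreover have "word_at x (int (length u) * (j + 1)) (length u * k) = concat (replicate k u)"
        by (rule Suc)
      ultimately show ?case
        by (simp add: word_at_add algebra_simps)
    qed simp
    have "word_at x i n \<in> gap_words S" for i n
    proof -
      let ?l = "int (length u)"
      have i: "i = ?l * (i div ?l) + int (nat (i mod ?l))" using u0 by simp
      define a where "a = nat (i mod ?l)"
      have "a + n \<le> length u * (a + n)" using u0 by (cases "length u") auto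
      then obtain b where b: "length u * (a + n) = a + (n + b)"
        unfolding le_iff_add by (auto simp: add.assoc)
      have "concat (replicate (a + n) u) =
          word_at x (?l * (i div ?l)) a @ word_at x i n @ word_at x (i + int n) b"
        unfolding per[of "i div ?l" "a + n", symmetric] b word_at_add
        using i by (simp add: a_def)
      then have "sublist (word_at x i n) (concat (replicate (a + n) u))"
        by (metis sublist_appendI)
      moreover have "concat (replicate k u) = ?c (concat (replicate k (ns @ [s])))" for k
        by (induction k) (auto simp: u_def)
      moreover have "set (concat (replicate k (ns @ [s]))) \<subseteq> S" for k
        using ns s by (induction k) auto
      ultimately show ?thesis unfolding gap_words_def mem_Collect_eq
        by (intro exI[of _ "concat (replicate (a + n) (ns @ [s]))"] conjI) (use ns s in simp_all)
    qed
    then have x: "x \<in> gap_shift S" by (simp add: gap_shift_def)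
    obtain p q where "u = p @ w @ q" using ns(2) by (auto simp: sublist_def u_def)
    moreover have "word_at x 0 (length u) = u" using per[of 0 1] by simp
    ultimately have "word_at x 0 (length p + (length w + length q)) = p @ w @ q" by simp
    then have "word_at x (int (length p)) (length w) = w"
      unfolding word_at_add by simp
    then show "w \<in> language (gap_shift S)" using word_at_in_language[OF x] by metis
  qed
qed

lemma map_filter_append [simp]:
  "List.map_filter f (xs @ ys) = List.map_filter f xs @ List.map_filter f ys"
  by (simp add: List.map_filter_def)

lemma unstar:
  fixes x :: "int \<Rightarrow> 'a option"
  assumes nn: "\<And>i. x i = None \<Longrightarrow> x (i + 1) \<noteq> None"
  obtains y where "\<forall>i n. \<exists>j m. word_at y i n = List.map_filter id (word_at x j m)"
    and "\<forall>j m. \<exists>i n. sublist (List.map_filter id (word_at x j m)) (word_at y i n)"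
    and "range y \<subseteq> {a. Some a \<in> range x}"
proof -
  define nx where "nx i = (if x (i + 1) = None then i + 2 else i + 1)" for i
  define pv where "pv i = (if x (i - 1) = None then i - 2 else i - 1)" for i
  have nx: "x (nx i) \<noteq> None" "nx i > i" for i
    using nn[of "i + 1"] by (auto simp: nx_def algebra_simps)
  have pv: "x (pv i) \<noteq> None" "pv i < i" for i
    using nn[of "i - 2"] by (cases "x (i - 2)") (auto simp: pv_def)
  have nxpv: "nx (pv i) = i" if "x i \<noteq> None" for i
    using that nn[of "i - 2"] by (auto simp: pv_def nx_def algebra_simps)
  obtain p0 where p0: "x p0 \<noteq> None" using nn by blast
  define g where "g i = (if i \<ge> 0 then (nx ^^ nat i) p0 else (pv ^^ nat (- i)) p0)" for i :: int
  have gx: "x (g i) \<noteq> None" for i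
  proof (cases "i \<ge> 0")
    case True then show ?thesis using p0 nx(1) by (cases "nat i") (auto simp: g_def)
  next
    case False then show ?thesis using p0 pv(1) by (cases "nat (- i)") (auto simp: g_def)
  qed
  have gs: "g (i + 1) = nx (g i)" for i
  proof (cases "i \<ge> 0")
    case True
    then have "nat (i + 1) = Suc (nat i)" by simp
    then show ?thesis using True by (simp add: g_def)
  next
    case False
    then have "nat (- i) = Suc (nat (- (i + 1)))" by simp
    then have "g i = pv (g (i + 1))" using False by (auto simp: g_def)
    then show ?thesis using nxpv[OF gx] by simp
  qed
  have up: "g i + int n \<le> g (i + int n)" for i n
  proof (induction n)
    case (Suc n)
    show ?case using Suc nx(2)[of "g (i + int n)"] gs[of "i + int n"] by (simp add: algebra_simps)
  qed simp
  define y where "y i = the (x (g i))" for i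
  have step: "List.map_filter id (word_at x (g i) (nat (g (i + 1) - g i))) = [y i]" for i
    using gx[of i] by (auto simp: gs nx_def y_def List.map_filter_def word_at_Suc numeral_2_eq_2)
  have yw: "List.map_filter id (word_at x (g i) (nat (g (i + int n) - g i))) = word_at y i n" for i n
  proof (induction n arbitrary: i)
    case (Suc n)
    have "nat (g (i + int (Suc n)) - g i)
        = nat (g (i + 1) - g i) + nat (g (i + 1 + int n) - g (i + 1))"
      using up[of i 1] up[of "i + 1" n] by (simp add: algebra_simps)
    moreover have "g i + int (nat (g (i + 1) - g i)) = g (i + 1)" using up[of i 1] by simp
    ultimately show ?case using step[of i] Suc[of "i + 1"]
      by (simp only: word_at_add map_filter_append word_at_Suc of_nat_Suc ac_simps append_Cons append_Nil)
  qed (simp add: List.map_filter_def)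
  show thesis
  proof
    show "\<forall>i n. \<exists>j m. word_at y i n = List.map_filter id (word_at x j m)"
      using yw by metis
    show "\<forall>j m. \<exists>i n. sublist (List.map_filter id (word_at x j m)) (word_at y i n)"
    proof (intro allI)
      fix j m
      define i where "i = - int (nat (p0 - j))"
      define n where "n = nat (p0 - j) + nat (j + int m - p0)"
      have g0: "g 0 = p0" by (simp add: g_def)
      have "i + int (nat (p0 - j)) = 0" by (simp add: i_def)
      then have a: "g i \<le> j" using up[of i "nat (p0 - j)"] g0 by (cases "j \<le> p0") auto
      have b: "j + int m \<le> g (i + int n)"
        using up[of 0 "nat (j + int m - p0)"] g0
        by (cases "p0 \<le> j + int m") (auto simp: i_def n_def)
      define k where "k = nat (j - g i)"
      define l where "l = nat (g (i + int n) - (j + int m))"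
      have "nat (g (i + int n) - g i) = k + (m + l)" "g i + int k = j"
        using a b by (auto simp: k_def l_def)
      then have "word_at x (g i) (nat (g (i + int n) - g i))
          = word_at x (g i) k @ word_at x j m @ word_at x (j + int m) l"
        by (simp add: word_at_add)
      then have "word_at y i n = List.map_filter id (word_at x (g i) k) @
          List.map_filter id (word_at x j m) @ List.map_filter id (word_at x (j + int m) l)"
        using yw[of i n] by simp
      then show "\<exists>i n. sublist (List.map_filter id (word_at x j m)) (word_at y i n)"
        by (metis sublist_appendI)
    qed
    show "range y \<subseteq> {a. Some a \<in> range x}"
      using gx by (auto simp: y_def)
  qed
qed

theorem star_avoiding_eq_star_studded:
  "star_avoiding A \<F> = star_studded A (avoiding A \<F>)"
proof -
  let ?h = "List.map_filter id :: 'a option list \<Rightarrow> 'a list"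
  have lang: "w \<notin> \<F>" if "w \<in> language (avoiding A \<F>)" for w
    using that by (auto simp: language_def avoiding_def) (metis length_word_at)
  have h: "?h w \<in> lists A" if "w \<in> lists (star_alphabet A)" for w
    using that by (fastforce simp: List.map_filter_def star_alphabet_def)
  show ?thesis
  proof
    show "star_studded A (avoiding A \<F>) \<subseteq> star_avoiding A \<F>"
      unfolding star_studded_def star_avoiding_def avoiding_def[of "star_alphabet A"]
      using h lang by blast
    show "star_avoiding A \<F> \<subseteq> star_studded A (avoiding A \<F>)"
    proof
      fix x assume x: "x \<in> star_avoiding A \<F>"
      have rx: "range x \<subseteq> star_alphabet A"
        and dbl: "\<And>i. word_at x i 2 \<noteq> [None, None]"
        and fb: "\<And>w i. w \<in> lists (star_alphabet A) \<Longrightarrow> ?h w \<in> \<F> \<Longrightarrow> word_at x i (length w) \<noteq> w"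
        using x by (auto simp: star_avoiding_def avoiding_def numeral_2_eq_2)
      have wl: "word_at x i n \<in> lists (star_alphabet A)" for i n
        using rx by (auto simp: word_at_def image_subset_iff)
      have fb': "?h (word_at x i n) \<notin> \<F>" for i n
        using fb[OF wl] by (metis length_word_at)
      have nn: "x i = None \<Longrightarrow> x (i + 1) \<noteq> None" for i
        using dbl[of i] by (auto simp: word_at_Suc numeral_2_eq_2)
      obtain y where y: "\<forall>i n. \<exists>j m. word_at y i n = ?h (word_at x j m)"
        "\<forall>j m. \<exists>i n. sublist (?h (word_at x j m)) (word_at y i n)"
        "range y \<subseteq> {a. Some a \<in> range x}"
        by (rule unstar[where x = x, OF nn])
      have "range y \<subseteq> A" using y(3) rx by (auto simp: star_alphabet_def)
      moreover have "word_at y i n \<notin> \<F>" for i n using y(1) fb' by metis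
      ultimately have yX: "y \<in> avoiding A \<F>"
        by (auto simp: avoiding_def) metis
      have "?h (word_at x j m) \<in> language (avoiding A \<F>)" for j m
      proof -
        obtain i n p q where e: "word_at y i n = p @ ?h (word_at x j m) @ q"
          using y(2) unfolding sublist_def by blast
        let ?w = "?h (word_at x j m)"
        have "n = length p + (length ?w + length q)"
          using arg_cong[OF e, of length] by simp
        then have "word_at y (i + int (length p)) (length ?w) = ?w"
          using e by (simp add: word_at_add)
        then show ?thesis using word_at_in_language[OF yX] by metis
      qed
      then show "x \<in> star_studded A (avoiding A \<F>)"
        unfolding star_studded_def star_avoiding_def avoiding_def[of "star_alphabet A"]
        using rx dbl by (auto simp: numeral_2_eq_2) (metis DiffD2)+
    qed
  qed
qed

end

theory Submission
  imports Defs
begin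

text \<open>If the gap shift is not sofic, then \<open>S\<close> is not eventually periodic, so two left tails ending in
  \<open>0 1^a\<close> and \<open>0 1^c\<close> have the same followers only if \<open>a = c\<close>. Whether a left half and a right half of
  configurations may be joined depends only on the number \<open>a\<close> of ones after the last zero on the
  left and the number \<open>b\<close> of ones before the first zero on the right, through \<open>a + b \<in> S\<close>.

  The automaton exchanges every star with the letter to its right. Stars then move rigidly with
  speed 1, so in every other direction the pattern of stars is swept over the window, and in the
  direction of the stars it is the letters that are swept.

  For direct primeness, let \<open>p\<close> and \<open>q\<close> be the components of a conjugacy onto \<open>Y \<times> Z\<close> and let
  \<open>mix x x'\<close> be the point with \<open>p\<close>-component that of \<open>x\<close> and \<open>q\<close>-component that of \<open>x'\<close>. Joining two
  halves is possible iff it is possible in both components, which writes \<open>S\<close>, up to finitely many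
  elements, as \<open>A \<inter> B\<close>. A left half with \<open>a\<close> ones mixed with one with \<open>a'\<close> ones has some number \<open>c\<close> of
  ones, and since its components are those of the two halves, \<open>A\<close> is eventually invariant under
  translation by \<open>c - a\<close> and \<open>B\<close> under \<open>c - a'\<close>. As \<open>S\<close> is not eventually periodic, one of \<open>A\<close>, \<open>B\<close> is
  not, say \<open>A\<close>; hence always \<open>c = a\<close>. Counting ones to the right of a faraway zero
  then gives \<open>mix 1 x = 1\<close> for every \<open>x\<close> that is 1 outside a finite window, so \<open>q\<close> is constant on
  such points, hence everywhere, and \<open>Z\<close> is trivial.\<close>

section \<open>Gap words and the star-studded gap shift\<close>

declare One_nat_def [simp del]

abbreviation blocks :: "nat list \<Rightarrow> nat list" where
  "blocks ns \<equiv> concat (map (\<lambda>n. 0 # replicate n 1) ns)"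

text \<open>A zero occurs only as the first letter of a block, so a cut just before a zero never
  goes through a block.\<close>

lemma blocks_split_at_zero:
  assumes "blocks ns = p @ 0 # q"
  obtains ms ks where "ns = ms @ ks" "blocks ms = p" "blocks ks = 0 # q"
proof -
  have "\<exists>ms ks. ns = ms @ ks \<and> blocks ms = p \<and> blocks ks = 0 # q"
    using assms
  proof (induction ns arbitrary: p)
    case (Cons n ns)
    show ?case
    proof (cases p)
      case Nil
      then have "[] @ (n # ns) = n # ns \<and> blocks [] = p \<and> blocks (n # ns) = 0 # q"
        using Cons.prems by simp
      then show ?thesis by metis
    next
      case (Cons a p')
      then have a: "a = 0" and e: "replicate n 1 @ blocks ns = p' @ 0 # q"
        using Cons.prems by auto
      obtain us where us: "replicate n 1 @ us = p'" "blocks ns = us @ 0 # q"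
      proof -
        from e consider us where "replicate n 1 @ us = p'" "blocks ns = us @ 0 # q"
          | us where "replicate n 1 = p' @ us" "us @ blocks ns = 0 # q"
          by (auto simp: append_eq_append_conv2)
        then show thesis
        proof cases
          case 2
          \<comment> \<open>\<open>us\<close> ends a run of ones and begins a word starting with 0,
            so a first letter of \<open>us\<close> would be both 1 and 0.\<close>
          have "us = []"
          proof (cases us)
            case (Cons b us')
            with 2 have "b = 0" "b \<in> set (replicate n (1::nat))" by auto
            then show ?thesis by simp
          qed
          with 2 that show thesis by auto
        qed (use that in blast)
      qed
      from Cons.IH[OF us(2)] obtain ms ks where
        "ns = ms @ ks" "blocks ms = us" "blocks ks = 0 # q" by blast
      with a us(1) Cons show ?thesis by (intro exI[of _ "n # ms"] exI[of _ ks]) auto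
    qed
  qed simp
  with that show thesis by blast
qed

lemma blocks_starting_with:
  assumes "blocks ns = 0 # replicate n 1 @ 0 # q"
  shows "n \<in> set ns"
proof (cases ns)
  case (Cons m ms)
  \<comment> \<open>\<open>blocks ms\<close> is empty or starts with 0, so the initial run of ones
    has length exactly \<open>m\<close>.\<close>
  have *: "takeWhile (\<lambda>a. a = 1) (replicate m 1 @ blocks ms) = replicate m (1::nat)"
    by (cases ms) (simp_all add: takeWhile_append)
  have "replicate m 1 @ blocks ms = replicate n 1 @ 0 # q" using assms Cons by simp
  with * have "replicate m 1 = takeWhile (\<lambda>a. a = 1) (replicate n 1 @ 0 # q)" by simp
  also have "\<dots> = replicate n (1::nat)" by (simp add: takeWhile_append)
  finally have "m = n" by (simp add: replicate_eq_replicate)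
  then show ?thesis using Cons by simp
qed (use assms in simp)

lemma sublist_blocks_gap:
  assumes "sublist (0 # replicate n 1 @ [0]) (blocks ns)"
  shows "n \<in> set ns"
proof -
  obtain p q where "blocks ns = p @ 0 # (replicate n 1 @ 0 # q)"
    using assms by (auto simp: sublist_def)
  then obtain ms ks where "ns = ms @ ks" "blocks ks = 0 # (replicate n 1 @ 0 # q)"
    by (rule blocks_split_at_zero)
  then show ?thesis using blocks_starting_with[of ks n q] by simp
qed

text \<open>The word is built up from its right end. A new 0 closes the initial run of ones: in
  front of a word of ones it opens the last, unfinished block; otherwise the run lies between two
  zeros and the hypothesis puts its length in \<open>S\<close>.\<close>

lemma binary_word_shape:
  assumes "set w \<subseteq> {0, 1}" "\<And>n. sublist (0 # replicate n 1 @ [0]) w \<Longrightarrow> n \<in> S"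
  shows "(\<exists>a. w = replicate a 1) \<or>
    (\<exists>a b ns. set ns \<subseteq> S \<and> w = replicate a 1 @ blocks ns @ 0 # replicate b 1)"
  using assms
proof (induction w)
  case (Cons c w)
  have "sublist (0 # replicate n 1 @ [0]) w \<Longrightarrow> n \<in> S" for n
    by (rule Cons.prems(2)) (simp add: sublist_Cons_right)
  with Cons consider a where "w = replicate a 1"
    | a b ns where "set ns \<subseteq> S" "w = replicate a 1 @ blocks ns @ 0 # replicate b 1"
    by fastforce
  then show ?case
  proof cases
    case 1
    show ?thesis
    proof (cases "c = 1")
      case True
      with 1 have "c # w = replicate (Suc a) 1" by simp
      then show ?thesis by blast
    next
      case False
      with Cons.prems 1 have "c # w = replicate 0 1 @ blocks [] @ 0 # replicate a 1" by simp
      then show ?thesis by (intro disjI2 exI[of _ "0::nat"] exI[of _ a] exI[of _ "[]"]) simp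
    qed
  next
    case 2
    show ?thesis
    proof (cases "c = 1")
      case True
      with 2 have "c # w = replicate (Suc a) 1 @ blocks ns @ 0 # replicate b 1" by simp
      with 2 show ?thesis by blast
    next
      case False
      then have c: "c = 0" using Cons.prems by simp
      obtain v where v: "blocks ns @ 0 # replicate b 1 = 0 # v" by (cases ns) auto
      have "c # w = [] @ (0 # replicate a 1 @ [0]) @ v" using 2 c v by simp
      then have "sublist (0 # replicate a 1 @ [0]) (c # w)" by (metis sublist_appendI)
      then have "a \<in> S" by (rule Cons.prems(2))
      then have "set (a # ns) \<subseteq> S" "c # w = replicate 0 1 @ blocks (a # ns) @ 0 # replicate b 1"
        using 2 c by auto
      then show ?thesis by blast
    qed
  qed
qed (auto intro: exI[of _ 0])

lemma infinite_nat_ge: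
  assumes "infinite (S :: nat set)"
  obtains s where "s \<in> S" "n \<le> s"
  using assms by (auto simp: infinite_nat_iff_unbounded_le)

lemma set_blocks: "set (blocks ns) \<subseteq> {0, 1}"
  by (induction ns) (auto simp: set_replicate_conv_if)

text \<open>The runs of ones at the two ends may be parts of longer blocks. An infinite
  \<open>S\<close> contains a long enough block length for each of them, so only the runs between
  two zeros are restricted.\<close>

lemma gap_words_iff:
  assumes "infinite S"
  shows "w \<in> gap_words S \<longleftrightarrow>
    set w \<subseteq> {0, 1} \<and> (\<forall>n. sublist (0 # replicate n 1 @ [0]) w \<longrightarrow> n \<in> S)"
proof
  assume "w \<in> gap_words S"
  then obtain ns where ns: "set ns \<subseteq> S" "sublist w (blocks ns)" by (auto simp: gap_words_def)
  then show "set w \<subseteq> {0, 1} \<and> (\<forall>n. sublist (0 # replicate n 1 @ [0]) w \<longrightarrow> n \<in> S)"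
  proof (intro conjI allI impI)
    show "set w \<subseteq> {0, 1}" using set_mono_sublist[OF ns(2)] set_blocks by blast
    fix n assume "sublist (0 # replicate n 1 @ [0]) w"
    then have "sublist (0 # replicate n 1 @ [0]) (blocks ns)"
      using ns(2) by (rule sublist_order.order.trans)
    then show "n \<in> S" using sublist_blocks_gap ns(1) by blast
  qed
next
  assume w: "set w \<subseteq> {0, 1} \<and> (\<forall>n. sublist (0 # replicate n 1 @ [0]) w \<longrightarrow> n \<in> S)"
  consider a where "w = replicate a 1"
    | a b ns where "set ns \<subseteq> S" "w = replicate a 1 @ blocks ns @ 0 # replicate b 1"
    using binary_word_shape[OF conjunct1[OF w], of S] w by metis
  then show "w \<in> gap_words S"
  proof cases
    case 1
    obtain s where s: "s \<in> S" "a \<le> s" using infinite_nat_ge[OF assms] .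
    then have "replicate s (1::nat) = replicate a 1 @ replicate (s - a) 1"
      by (metis le_add_diff_inverse replicate_add)
    then have "blocks [s] = [0] @ w @ replicate (s - a) 1"
      using 1 by simp
    then have "sublist w (blocks [s])" by (metis sublist_appendI)
    with s show ?thesis unfolding gap_words_def by (intro CollectI exI[of _ "[s]"]) simp
  next
    case 2
    obtain s where s: "s \<in> S" "a \<le> s" using infinite_nat_ge[OF assms] .
    obtain t where t: "t \<in> S" "b \<le> t" using infinite_nat_ge[OF assms] .
    have "replicate s (1::nat) = replicate (s - a) 1 @ replicate a 1"
      "replicate t (1::nat) = replicate b 1 @ replicate (t - b) 1"
      using s t by (metis le_add_diff_inverse le_add_diff_inverse2 replicate_add)+
    then have "blocks (s # ns @ [t]) = (0 # replicate (s - a) 1) @ w @ replicate (t - b) 1"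
      using 2 by simp
    then have "sublist w (blocks (s # ns @ [t]))" by (metis sublist_appendI)
    moreover have "set (s # ns @ [t]) \<subseteq> S" using 2 s t by simp
    ultimately show ?thesis unfolding gap_words_def mem_Collect_eq by (intro exI conjI)
  qed
qed

section \<open>Erasing the stars\<close>

definition letters :: "'a option list \<Rightarrow> 'a list" where
  "letters w = List.map_filter id w"

lemma letters_simps [simp]:
  "letters [] = []" "letters (None # w) = letters w" "letters (Some a # w) = a # letters w"
  "letters (u @ v) = letters u @ letters v"
  by (simp_all add: letters_def List.map_filter_def)

lemma set_letters: "a \<in> set (letters w) \<longleftrightarrow> Some a \<in> set w"
  by (force simp: letters_def List.map_filter_def)

lemma letters_split:
  assumes "letters w = p @ a # q"
  obtains u v where "w = u @ Some a # v" "letters u = p" "letters v = q"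
proof -
  have "\<exists>u v. w = u @ Some a # v \<and> letters u = p \<and> letters v = q"
    using assms
  proof (induction w arbitrary: p)
    case (Cons c w)
    show ?case
    proof (cases "p = [] \<and> c \<noteq> None")
      case True
      with Cons.prems show ?thesis by (intro exI[of _ "[]"] exI[of _ w]) auto
    next
      case False
      \<comment> \<open>What remains of \<open>p\<close> after \<open>c\<close>: a star uses up
        nothing, a letter uses up the head.\<close>
      define p' where "p' = (case c of None \<Rightarrow> p | Some _ \<Rightarrow> tl p)"
      have "letters w = p' @ a # q" "letters [c] @ p' = p"
        using Cons.prems False by (auto simp: p'_def Cons_eq_append_conv split: option.splits)
      with Cons.IH[of p'] obtain u v where "w = u @ Some a # v" "letters u = p'" "letters v = q"
        by blast
      with \<open>letters [c] @ p' = p\<close> show ?thesis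
        by (intro exI[of _ "c # u"] exI[of _ v]) (cases c; simp)
    qed
  qed simp
  with that show thesis by blast
qed

lemma letters_in_lists: "w \<in> lists (star_alphabet A) \<Longrightarrow> letters w \<in> lists A"
  by (auto simp: in_lists_conv_set set_letters star_alphabet_def)

lemma word_at_in_lists: "(\<And>i. x i \<in> A) \<Longrightarrow> word_at x i n \<in> lists A"
  by (auto simp: word_at_def)

text \<open>Every word of a configuration over the star alphabet erases to a word over
  \<open>A\<close>, so avoiding the forbidden words means that all erased words lie in the
  language.\<close>

lemma star_studded_iff:
  "x \<in> star_studded A X \<longleftrightarrow> (\<forall>i. x i \<in> star_alphabet A) \<and>
    (\<forall>i. x i = None \<longrightarrow> x (i + 1) \<noteq> None) \<and> (\<forall>i n. letters (word_at x i n) \<in> language X)"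
  (is "?l \<longleftrightarrow> ?a \<and> ?n \<and> ?w")
proof -
  have range: "range x \<subseteq> star_alphabet A \<longleftrightarrow> ?a" by (simp add: image_subset_iff)
  have pair: "(\<forall>i. word_at x i (length [None, None]) \<noteq> [None, None]) \<longleftrightarrow> ?n"
    by (simp add: word_at_Suc numeral_2_eq_2) (metis not_Some_eq)
  have words: "(\<forall>w\<in>{w \<in> lists (star_alphabet A). letters w \<in> lists A - language X}.
      \<forall>i. word_at x i (length w) \<noteq> w) \<longleftrightarrow> ?w" (is "?v \<longleftrightarrow> _") if ?a
  proof
    assume v: ?v
    show ?w
    proof (intro allI)
      fix i n
      have "word_at x i n \<in> lists (star_alphabet A)" using that by (intro word_at_in_lists) simp
      with v letters_in_lists[OF this] show "letters (word_at x i n) \<in> language X"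
        by (metis (mono_tags, lifting) DiffI length_word_at mem_Collect_eq)
    qed
  next
    assume w: ?w
    show ?v
    proof (intro ballI allI notI)
      fix w i assume "w \<in> {w \<in> lists (star_alphabet A). letters w \<in> lists A - language X}"
        "word_at x i (length w) = w"
      moreover from w have "letters (word_at x i (length w)) \<in> language X" by simp
      ultimately show False by simp
    qed
  qed
  have "?l \<longleftrightarrow> range x \<subseteq> star_alphabet A \<and>
    (\<forall>i. word_at x i (length [None, None]) \<noteq> [None, None]) \<and>
    (\<forall>w\<in>{w \<in> lists (star_alphabet A). letters w \<in> lists A - language X}.
      \<forall>i. word_at x i (length w) \<noteq> w)"
    by (simp add: star_studded_def star_avoiding_def avoiding_def letters_def)
  then show ?thesis unfolding range pair by (rule trans) (intro conj_cong refl words)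
qed

lemma word_at_Suc_snoc: "word_at x i (Suc n) = word_at x i n @ [x (i + int n)]"
  by (simp add: word_at_def)

lemma word_at_eq_append:
  assumes "word_at x i n = u @ v"
  shows "word_at x i (length u) = u" "word_at x (i + int (length u)) (length v) = v"
proof -
  have "n = length u + length v" using arg_cong[OF assms, of length] by simp
  with assms show "word_at x i (length u) = u" "word_at x (i + int (length u)) (length v) = v"
    by (simp_all add: word_at_add)
qed

lemma word_at_eq_Cons:
  assumes "word_at x i n = a # v"
  shows "x i = a" "word_at x (i + 1) (length v) = v"
  using assms by (cases n; simp add: word_at_Suc; force)+

lemma in_word_at: "i \<le> k \<Longrightarrow> k < i + int n \<Longrightarrow> x k \<in> set (word_at x i n)"
  unfolding word_at_def set_map by (rule image_eqI[where x = "nat (k - i)"]) auto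

lemma letters_ones:
  assumes "\<forall>k\<in>{i..<i + int n}. x k = None \<or> x k = Some 1"
  shows "letters (word_at x i n) = replicate (card {k \<in> {i..<i + int n}. x k = Some (1::nat)}) 1"
  using assms
proof (induction n)
  case (Suc n)
  have e: "{i..<i + int (Suc n)} = insert (i + int n) {i..<i + int n}" by auto
  have IH: "letters (word_at x i n) = replicate (card {k \<in> {i..<i + int n}. x k = Some 1}) 1"
    using Suc by auto
  have "x (i + int n) = None \<or> x (i + int n) = Some 1" using Suc.prems by simp
  have fin: "finite {k \<in> {i..<i + int n}. x k = Some 1}"
    and nin: "i + int n \<notin> {k \<in> {i..<i + int n}. x k = Some 1}"
    by (rule finite_subset[of _ "{i..<i + int n}"]) auto
  from \<open>x (i + int n) = None \<or> x (i + int n) = Some 1\<close> show ?case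
  proof
    assume n: "x (i + int n) = None"
    then have "{k \<in> {i..<i + int (Suc n)}. x k = Some 1} = {k \<in> {i..<i + int n}. x k = Some 1}"
      unfolding e by auto
    with IH n show ?thesis unfolding word_at_Suc_snoc by simp
  next
    assume n: "x (i + int n) = Some 1"
    then have "{k \<in> {i..<i + int (Suc n)}. x k = Some 1} =
        insert (i + int n) {k \<in> {i..<i + int n}. x k = Some 1}"
      unfolding e by auto
    then have "card {k \<in> {i..<i + int (Suc n)}. x k = Some 1} =
        Suc (card {k \<in> {i..<i + int n}. x k = Some 1})"
      by (simp only: card_insert_disjoint[OF fin nin])
    with IH n show ?thesis unfolding word_at_Suc_snoc by (simp add: replicate_append_same)
  qed
qed simp

text \<open>Stars inside a gap do not count, so a gap length is a number of ones and not a distance.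
  Half-open intervals make the counts additive under cutting.\<close>

definition ones :: "(int \<Rightarrow> nat option) \<Rightarrow> int \<Rightarrow> int \<Rightarrow> nat" where
  "ones x i j = card {k \<in> {i..<j}. x k = Some 1}"

definition no_zero :: "(int \<Rightarrow> nat option) \<Rightarrow> int \<Rightarrow> int \<Rightarrow> bool" where
  "no_zero x i j \<longleftrightarrow> (\<forall>k\<in>{i..<j}. x k \<noteq> Some 0)"

abbreviation star_gap :: "nat set \<Rightarrow> (int \<Rightarrow> nat option) set" where
  "star_gap S \<equiv> star_studded {0, 1} (gap_shift S)"

text \<open>By \<open>gap_words_iff\<close> only pairs of consecutive zeros carry a condition; runs
  of ones that no zero bounds on one side are free because \<open>S\<close> is infinite.\<close>

lemma star_gap_iff:
  assumes "infinite S"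
  shows "x \<in> star_gap S \<longleftrightarrow> (\<forall>i. x i = None \<or> x i = Some 0 \<or> x i = Some 1) \<and>
    (\<forall>i. x i = None \<longrightarrow> x (i + 1) \<noteq> None) \<and>
    (\<forall>i j. i < j \<longrightarrow> x i = Some 0 \<longrightarrow> x j = Some 0 \<longrightarrow> no_zero x (i + 1) j \<longrightarrow> ones x (i + 1) j \<in> S)"
    (is "?l \<longleftrightarrow> ?a \<and> ?n \<and> ?z")
proof -
  have al: "(\<forall>i. x i \<in> star_alphabet {0, 1}) \<longleftrightarrow> ?a" by (auto simp: star_alphabet_def)
  have "S \<noteq> {}" using assms by auto
  note lang = language_gap_shift[OF this]
  have "(\<forall>i n. letters (word_at x i n) \<in> gap_words S) \<longleftrightarrow> ?z" if a: ?a
  proof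
    assume L: "\<forall>i n. letters (word_at x i n) \<in> gap_words S"
    show ?z
    proof (intro allI impI)
      fix i j assume ij: "i < j" "x i = Some 0" "x j = Some 0" "no_zero x (i + 1) j"
      define n where "n = nat (j - i - 1)"
      have n: "j = i + 1 + int n" using ij by (simp add: n_def)
      have "letters (word_at x (i + 1) n) = replicate (ones x (i + 1) j) 1"
        unfolding ones_def n using ij(4) a by (intro letters_ones) (auto simp: no_zero_def n)
      moreover have "word_at x i (Suc (Suc n)) = Some 0 # word_at x (i + 1) n @ [Some 0]"
        using ij n unfolding word_at_Suc[of x i] word_at_Suc_snoc[of x "i + 1"] by simp
      ultimately have "letters (word_at x i (Suc (Suc n))) = 0 # replicate (ones x (i + 1) j) 1 @ [0]"
        by simp
      then show "ones x (i + 1) j \<in> S"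
        using L[rule_format, of i "Suc (Suc n)"] unfolding gap_words_iff[OF assms] by simp
    qed
  next
    assume z: ?z
    show "\<forall>i n. letters (word_at x i n) \<in> gap_words S"
      unfolding gap_words_iff[OF assms]
    proof (intro allI impI conjI)
      fix i n
      show "set (letters (word_at x i n)) \<subseteq> {0, 1}"
      proof
        fix b assume "b \<in> set (letters (word_at x i n))"
        then obtain k where "x k = Some b" by (auto simp: set_letters word_at_def)
        with a[rule_format, of k] show "b \<in> {0, 1}" by auto
      qed
      fix m assume "sublist (0 # replicate m 1 @ [0]) (letters (word_at x i n))"
      then obtain p q where "letters (word_at x i n) = p @ 0 # (replicate m 1 @ 0 # q)"
        by (auto simp: sublist_def)
      \<comment> \<open>The two zeros are pulled back through \<open>letters\<close> to the cells
        \<open>i'\<close> and \<open>i' + 1 + k\<close>; only stars and ones lie between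
        these.\<close>
      then obtain w1 w2 where w1: "word_at x i n = w1 @ Some 0 # w2" "letters w2 = replicate m 1 @ 0 # q"
        by (rule letters_split)
      from w1(2) obtain w3 w4 where w3: "w2 = w3 @ Some 0 # w4" "letters w3 = replicate m 1"
        by (rule letters_split)
      define i' where "i' = i + int (length w1)"
      define k where "k = length w3"
      have "word_at x i n = w1 @ Some 0 # w3 @ Some 0 # w4" using w1 w3 by simp
      from word_at_eq_append(2)[OF this, folded i'_def] have x0: "x i' = Some 0"
        and "word_at x (i' + 1) (length (w3 @ Some 0 # w4)) = w3 @ Some 0 # w4"
        by (rule word_at_eq_Cons)+
      note w4 = word_at_eq_append[OF this(2), folded k_def]
      have x: "x i' = Some 0" "word_at x (i' + 1) k = w3" "x (i' + 1 + int k) = Some 0"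
        using x0 w4(1) word_at_eq_Cons(1)[OF w4(2)] by blast+
      have "x l = None \<or> x l = Some 1" if "l \<in> {i' + 1..<i' + 1 + int k}" for l
      proof (cases "x l")
        case (Some b)
        then have "b \<in> set (letters w3)"
          using in_word_at[of "i' + 1" l k x] that x(2) by (simp add: set_letters)
        then have "b = 1" unfolding w3(2) by (simp split: if_splits)
        then show ?thesis using Some by simp
      qed simp
      then have l: "\<forall>l\<in>{i' + 1..<i' + 1 + int k}. x l = None \<or> x l = Some 1" by blast
      have "m = ones x (i' + 1) (i' + 1 + int k)"
        using letters_ones[OF l] x(2) w3(2) unfolding ones_def by (simp add: replicate_eq_replicate)
      moreover have "no_zero x (i' + 1) (i' + 1 + int k)" unfolding no_zero_def using l by fastforce
      then have "ones x (i' + 1) (i' + 1 + int k) \<in> S" using z x(1,3) by simp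
      ultimately show "m \<in> S" by simp
    qed
  qed
  then show ?thesis unfolding star_studded_iff al lang by argo
qed

section \<open>Gluing configurations\<close>

definition glue :: "int \<Rightarrow> (int \<Rightarrow> 'a) \<Rightarrow> (int \<Rightarrow> 'a) \<Rightarrow> int \<Rightarrow> 'a" where
  "glue m x y = (\<lambda>i. if i < m then x i else y i)"

text \<open>A set instead of a number, to cover halves without zeros: these give the empty set and
  hence no condition in \<open>glue_iff\<close>. Otherwise the zero nearest to the seam gives
  exactly one element.\<close>

definition left_counts :: "(int \<Rightarrow> nat option) \<Rightarrow> int \<Rightarrow> nat set" where
  "left_counts x m = {ones x (i + 1) m | i. i < m \<and> x i = Some 0 \<and> no_zero x (i + 1) m}"

definition right_counts :: "(int \<Rightarrow> nat option) \<Rightarrow> int \<Rightarrow> nat set" where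
  "right_counts x m = {ones x m j | j. m \<le> j \<and> x j = Some 0 \<and> no_zero x m j}"

lemma ones_cong: "(\<And>k. i \<le> k \<Longrightarrow> k < j \<Longrightarrow> x k = y k) \<Longrightarrow> ones x i j = ones y i j"
  unfolding ones_def by (rule arg_cong[where f = card]) auto

lemma no_zero_cong: "(\<And>k. i \<le> k \<Longrightarrow> k < j \<Longrightarrow> x k = y k) \<Longrightarrow> no_zero x i j = no_zero y i j"
  by (auto simp: no_zero_def)

lemma ones_split:
  assumes "i \<le> m" "m \<le> j"
  shows "ones x i j = ones x i m + ones x m j"
proof -
  have "{k \<in> {i..<j}. x k = Some 1} = {k \<in> {i..<m}. x k = Some 1} \<union> {k \<in> {m..<j}. x k = Some 1}"
    using assms by auto
  moreover have "finite {k \<in> {i..<m}. x k = Some 1}" "finite {k \<in> {m..<j}. x k = Some 1}"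
    by (rule finite_subset[of _ "{i..<j}"], use assms in auto)+
  moreover have "{k \<in> {i..<m}. x k = Some 1} \<inter> {k \<in> {m..<j}. x k = Some 1} = {}" by auto
  ultimately show ?thesis unfolding ones_def by (simp only: card_Un_disjoint)
qed

lemma no_zero_split:
  "i \<le> m \<Longrightarrow> m \<le> j \<Longrightarrow> no_zero x i j \<longleftrightarrow> no_zero x i m \<and> no_zero x m j"
  unfolding no_zero_def by (simp add: ball_Un flip: ivl_disj_un_two(3)[of i m j])

lemma ones_le: "ones x i j \<le> nat (j - i)"
  unfolding ones_def by (rule order_trans[OF card_mono[of "{i..<j}"]]) auto

lemma ones_all: "(\<And>k. i \<le> k \<Longrightarrow> k < j \<Longrightarrow> x k = Some 1) \<Longrightarrow> ones x i j = nat (j - i)"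
proof -
  assume "\<And>k. i \<le> k \<Longrightarrow> k < j \<Longrightarrow> x k = Some 1"
  then have "{k \<in> {i..<j}. x k = Some 1} = {i..<j}" by auto
  then show ?thesis by (simp add: ones_def)
qed

lemma ones_full:
  assumes "ones x i j = nat (j - i)" "i \<le> k" "k < j"
  shows "x k = Some 1"
proof -
  have "card {k \<in> {i..<j}. x k = Some 1} = card {i..<j}"
    using assms(1) by (simp only: ones_def card_atLeastLessThan_int)
  then have "{k \<in> {i..<j}. x k = Some 1} = {i..<j}"
    by (intro card_subset_eq) auto
  moreover have "k \<in> {i..<j}" using assms(2,3) by simp
  ultimately show ?thesis by blast
qed

lemma left_counts_eqI:
  assumes "i < m" "x i = Some 0" "no_zero x (i + 1) m"
  shows "left_counts x m = {ones x (i + 1) m}"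
proof -
  have "j = i" if "j < m" "x j = Some 0" "no_zero x (j + 1) m" for j
  proof (rule ccontr)
    assume "j \<noteq> i"
    then consider "i < j" | "j < i" by linarith
    then show False using assms that by cases (auto simp: no_zero_def)
  qed
  with assms show ?thesis unfolding left_counts_def by blast
qed

lemma left_counts_cases:
  obtains "left_counts x m = {}" | a where "left_counts x m = {a}"
proof (cases "left_counts x m = {}")
  case False
  then obtain i where "i < m" "x i = Some 0" "no_zero x (i + 1) m"
    by (auto simp: left_counts_def)
  from left_counts_eqI[OF this] that show thesis by blast
qed (use that in blast)

lemma right_counts_eqI:
  assumes "m \<le> i" "x i = Some 0" "no_zero x m i"
  shows "right_counts x m = {ones x m i}"
proof -
  have "j = i" if "m \<le> j" "x j = Some 0" "no_zero x m j" for j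
  proof (rule ccontr)
    assume "j \<noteq> i"
    then consider "i < j" | "j < i" by linarith
    then show False using assms that by cases (auto simp: no_zero_def)
  qed
  with assms show ?thesis unfolding right_counts_def by blast
qed

text \<open>Pairs of zeros on one side of \<open>m\<close> inherit their condition from
  \<open>x\<close> or \<open>y\<close>. The only new pair is the one across \<open>m\<close>, and
  its count is the sum of the counts of the two halves.\<close>

lemma glue_iff:
  assumes S: "infinite S" and x: "x \<in> star_gap S" and y: "y \<in> star_gap S"
  shows "glue m x y \<in> star_gap S \<longleftrightarrow> \<not> (x (m - 1) = None \<and> y m = None) \<and>
    (\<forall>a\<in>left_counts x m. \<forall>b\<in>right_counts y m. a + b \<in> S)" (is "_ \<longleftrightarrow> ?n \<and> ?c")
proof -
  let ?z = "glue m x y"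
  have l: "?z k = x k" if "k < m" for k using that by (simp add: glue_def)
  have r: "?z k = y k" if "m \<le> k" for k using that by (simp add: glue_def)
  note xX = x[unfolded star_gap_iff[OF S]] and yX = y[unfolded star_gap_iff[OF S]]
  have a: "\<forall>i. ?z i = None \<or> ?z i = Some 0 \<or> ?z i = Some 1"
    using xX yX by (simp add: glue_def)
  have n: "(\<forall>i. ?z i = None \<longrightarrow> ?z (i + 1) \<noteq> None) \<longleftrightarrow> ?n"
  proof
    assume *: "\<forall>i. ?z i = None \<longrightarrow> ?z (i + 1) \<noteq> None"
    from *[rule_format, of "m - 1"] show ?n using l[of "m - 1"] r[of m] by auto
  next
    assume *: ?n
    show "\<forall>i. ?z i = None \<longrightarrow> ?z (i + 1) \<noteq> None"
    proof (intro allI impI)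
      fix i assume i: "?z i = None"
      consider "i + 1 < m" | "i = m - 1" | "m \<le> i" by linarith
      then show "?z (i + 1) \<noteq> None"
      proof cases
        case 1 then show ?thesis using i l[of i] l[of "i + 1"] xX by simp
      next
        case 2 then show ?thesis using i l[of i] r[of "i + 1"] * by simp
      next
        case 3 then show ?thesis using i r[of i] r[of "i + 1"] yX by simp
      qed
    qed
  qed
  have across: "no_zero ?z (i + 1) j \<longleftrightarrow> no_zero x (i + 1) m \<and> no_zero y m j"
    "ones ?z (i + 1) j = ones x (i + 1) m + ones y m j" if "i < m" "m \<le> j" for i j
  proof -
    have "no_zero ?z (i + 1) m = no_zero x (i + 1) m" "ones ?z (i + 1) m = ones x (i + 1) m"
      by (auto intro!: no_zero_cong ones_cong l)
    moreover have "no_zero ?z m j = no_zero y m j" "ones ?z m j = ones y m j"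
      by (auto intro!: no_zero_cong ones_cong r)
    ultimately show "no_zero ?z (i + 1) j \<longleftrightarrow> no_zero x (i + 1) m \<and> no_zero y m j"
      "ones ?z (i + 1) j = ones x (i + 1) m + ones y m j"
      using that no_zero_split[of "i + 1" m j ?z] ones_split[of "i + 1" m j ?z] by auto
  qed
  have c: "(\<forall>i j. i < j \<longrightarrow> ?z i = Some 0 \<longrightarrow> ?z j = Some 0 \<longrightarrow> no_zero ?z (i + 1) j \<longrightarrow>
      ones ?z (i + 1) j \<in> S) \<longleftrightarrow> ?c" (is "?g \<longleftrightarrow> _")
  proof
    assume g: ?g
    show ?c
    proof (intro ballI)
      fix a b assume "a \<in> left_counts x m" "b \<in> right_counts y m"
      then obtain i j where ij: "i < m" "x i = Some 0" "no_zero x (i + 1) m" "a = ones x (i + 1) m"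
        "m \<le> j" "y j = Some 0" "no_zero y m j" "b = ones y m j"
        by (auto simp: left_counts_def right_counts_def)
      then show "a + b \<in> S" using g[rule_format, of i j] across[of i j] l[of i] r[of j] by simp
    qed
  next
    assume c: ?c
    show ?g
    proof (intro allI impI)
      fix i j assume ij: "i < j" "?z i = Some 0" "?z j = Some 0" "no_zero ?z (i + 1) j"
      consider "j < m" | "m \<le> i" | "i < m" "m \<le> j" by linarith
      then show "ones ?z (i + 1) j \<in> S"
      proof cases
        case 1
        then have "no_zero ?z (i + 1) j = no_zero x (i + 1) j" "ones ?z (i + 1) j = ones x (i + 1) j"
          by (auto intro!: no_zero_cong ones_cong l)
        then show ?thesis using ij xX l[of i] l[of j] 1 by simp
      next
        case 2
        then have "no_zero ?z (i + 1) j = no_zero y (i + 1) j" "ones ?z (i + 1) j = ones y (i + 1) j"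
          by (auto intro!: no_zero_cong ones_cong r)
        then show ?thesis using ij yX r[of i] r[of j] 2 by simp
      next
        case 3
        with ij across[of i j] have nz: "no_zero x (i + 1) m" "no_zero y m j" by auto
        have "x i = Some 0" "y j = Some 0" using ij 3 l[of i] r[of j] by auto
        with 3 nz have "ones x (i + 1) m \<in> left_counts x m" "ones y m j \<in> right_counts y m"
          unfolding left_counts_def right_counts_def by blast+
        with c show ?thesis using across[of i j] 3 by simp
      qed
    qed
  qed
  show ?thesis unfolding star_gap_iff[OF S, of ?z] n c using a by simp
qed

section \<open>Shifts, truncations and points with a single zero\<close>

lemma word_at_shift [simp]: "word_at (shift p x) i n = word_at x (i + p) n"
  by (simp add: word_at_def shift_def add_ac)

lemma shift_shift [simp]: "shift p (shift q x) = shift (p + q) x"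
  by (simp add: shift_def add_ac)

lemma shift_0 [simp]: "shift 0 x = x"
  by (simp add: shift_def)

lemma star_studded_shift:
  assumes "x \<in> star_studded A X"
  shows "shift p x \<in> star_studded A X"
  unfolding star_studded_iff
proof (intro conjI allI impI)
  note x = assms[unfolded star_studded_iff]
  fix i n
  show "shift p x i \<in> star_alphabet A" using x by (simp add: shift_def)
  show "letters (word_at (shift p x) i n) \<in> language X" using x by simp
  show "shift p x (i + 1) \<noteq> None" if "shift p x i = None"
    using x[THEN conjunct2, THEN conjunct1, rule_format, of "i + p"] that
    by (simp add: shift_def add_ac)
qed

text \<open>Reduces a point to finitely many cells without leaving the shift, for infinite
  \<open>S\<close>: zeros survive only inside the window, and the gaps between them are
  unchanged.\<close>

definition pad :: "int \<Rightarrow> int \<Rightarrow> (int \<Rightarrow> nat option) \<Rightarrow> int \<Rightarrow> nat option" where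
  "pad i j x = (\<lambda>k. if i \<le> k \<and> k < j then x k else Some 1)"

lemma pad_in_star_gap:
  assumes S: "infinite S" and x: "x \<in> star_gap S"
  shows "pad i j x \<in> star_gap S"
proof -
  note xX = x[unfolded star_gap_iff[OF S]]
  show ?thesis unfolding star_gap_iff[OF S]
  proof (intro conjI allI impI)
    fix k show "pad i j x k = None \<or> pad i j x k = Some 0 \<or> pad i j x k = Some 1"
      using xX by (simp add: pad_def)
    show "pad i j x (k + 1) \<noteq> None" if "pad i j x k = None"
      using that xX by (auto simp: pad_def split: if_splits)
    fix l assume kl: "k < l" "pad i j x k = Some 0" "pad i j x l = Some 0" "no_zero (pad i j x) (k + 1) l"
    then have b: "i \<le> k" "l < j" by (auto simp: pad_def split: if_splits)
    then have "no_zero (pad i j x) (k + 1) l = no_zero x (k + 1) l"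
      "ones (pad i j x) (k + 1) l = ones x (k + 1) l"
      by (auto intro!: no_zero_cong ones_cong simp: pad_def)
    moreover have "x k = Some 0" "x l = Some 0" using kl b by (auto simp: pad_def)
    ultimately show "ones (pad i j x) (k + 1) l \<in> S" using xX kl by simp
  qed
qed

text \<open>A single zero meets no gap condition, and its halves serve as probes with a prescribed
  count: the zero at \<open>- a - 1\<close> leaves \<open>a\<close> ones before cell 0, the zero at
  \<open>b\<close> leaves \<open>b\<close> ones from cell 0 on.\<close>

definition zero_at :: "int \<Rightarrow> int \<Rightarrow> nat option" where
  "zero_at a = (\<lambda>k. if k = a then Some 0 else Some 1)"

abbreviation all_ones :: "int \<Rightarrow> nat option" where
  "all_ones \<equiv> \<lambda>_. Some 1"

lemma zero_at_in_star_gap: "infinite S \<Longrightarrow> zero_at a \<in> star_gap S"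
  unfolding star_gap_iff by (auto simp: zero_at_def split: if_splits)

lemma all_ones_in_star_gap: "infinite S \<Longrightarrow> all_ones \<in> star_gap S"
  unfolding star_gap_iff by auto

lemma left_counts_zero_at: "left_counts (zero_at (- int a - 1)) 0 = {a}"
proof -
  have "ones (zero_at (- int a - 1)) (- int a - 1 + 1) 0 = nat (0 - (- int a - 1 + 1))"
    by (rule ones_all) (simp add: zero_at_def)
  then show ?thesis
    using left_counts_eqI[of "- int a - 1" 0 "zero_at (- int a - 1)"]
    by (simp add: no_zero_def zero_at_def)
qed

lemma right_counts_zero_at: "right_counts (zero_at (int b)) 0 = {b}"
proof -
  have "ones (zero_at (int b)) 0 (int b) = nat (int b - 0)"
    by (rule ones_all) (simp add: zero_at_def)
  then show ?thesis
    using right_counts_eqI[of 0 "int b" "zero_at (int b)"]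
    by (simp add: no_zero_def zero_at_def)
qed

lemma glue_zero_at_iff:
  assumes "infinite S" "x \<in> star_gap S"
  shows "glue 0 x (zero_at (int b)) \<in> star_gap S \<longleftrightarrow> (\<forall>a\<in>left_counts x 0. a + b \<in> S)"
  unfolding glue_iff[OF assms zero_at_in_star_gap[OF assms(1)]] right_counts_zero_at
  by (simp add: zero_at_def)

section \<open>Eventually periodic gap sets\<close>

definition eventually_periodic :: "nat set \<Rightarrow> bool" where
  "eventually_periodic S \<longleftrightarrow> (\<exists>N p. p > 0 \<and> (\<forall>n\<ge>N. n \<in> S \<longleftrightarrow> n + p \<in> S))"

text \<open>The distance between \<open>a\<close> and \<open>c\<close> is a period from the smaller
  of them plus \<open>N\<close> on.\<close>

lemma eventually_periodicI:
  assumes "\<And>b. b \<ge> N \<Longrightarrow> a + b \<in> S \<longleftrightarrow> c + b \<in> S" "a \<noteq> c"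
  shows "eventually_periodic S"
proof -
  have *: "eventually_periodic S" if h: "\<And>b. b \<ge> N \<Longrightarrow> a + b \<in> S \<longleftrightarrow> c + b \<in> S" "a < c" for a c
  proof -
    have "n \<in> S \<longleftrightarrow> n + (c - a) \<in> S" if "n \<ge> a + N" for n
    proof -
      have "a + (n - a) = n" "c + (n - a) = n + (c - a)" using that h(2) by auto
      then show ?thesis using h(1)[of "n - a"] that by simp
    qed
    moreover have "c - a > 0" using h(2) by simp
    ultimately show ?thesis unfolding eventually_periodic_def by blast
  qed
  from assms(2) consider "a < c" | "c < a" by linarith
  then show ?thesis
  proof cases
    case 1 then show ?thesis using * assms(1) by blast
  next
    case 2 then show ?thesis using *[of c a] assms(1) by blast
  qed
qed

lemma eventually_periodic_cofinite:
  assumes "\<And>n. n \<ge> N \<Longrightarrow> n \<in> S"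
  shows "eventually_periodic S"
proof (rule eventually_periodicI[of N 0 S 1])
  fix b assume "b \<ge> N"
  then have "0 + b \<in> S" "1 + b \<in> S" by (auto intro: assms)
  then show "0 + b \<in> S \<longleftrightarrow> 1 + b \<in> S" by blast
qed simp

lemma finite_eventually_periodic:
  assumes "finite S"
  shows "eventually_periodic S"
proof -
  obtain N where "\<forall>n\<in>S. n < N" using assms finite_nat_set_iff_bounded by blast
  then have "\<not> 0 + b \<in> S" "\<not> 1 + b \<in> S" if "b \<ge> N" for b using that by fastforce+
  then show ?thesis by (intro eventually_periodicI[of N 0 S 1]) auto
qed

text \<open>Subtracting the period does not change the translate as long as the result is at least
  \<open>N\<close>, so every \<open>k\<close> can be brought below \<open>N + p\<close>. This will
  bound the number of follower sets.\<close>

lemma eventually_periodic_tails: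
  assumes "eventually_periodic S"
  obtains M where "\<And>k. \<exists>k'<M. {b. k + b \<in> S} = {b. k' + b \<in> S}"
proof -
  obtain N p where p: "p > 0" "\<And>n. n \<ge> N \<Longrightarrow> n \<in> S \<longleftrightarrow> n + p \<in> S"
    using assms by (auto simp: eventually_periodic_def)
  have "\<exists>k'<N + p. {b. k + b \<in> S} = {b. k' + b \<in> S}" for k
  proof (induction k rule: less_induct)
    case (less k)
    show ?case
    proof (cases "k < N + p")
      case False
      have "{b. k + b \<in> S} = {b. (k - p) + b \<in> S}"
      proof -
        have "k + b \<in> S \<longleftrightarrow> (k - p) + b \<in> S" for b
        proof -
          have "(k - p) + b + p = k + b" "N \<le> (k - p) + b" using False by auto
          then show ?thesis using p(2)[of "(k - p) + b"] by simp
        qed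
        then show ?thesis by blast
      qed
      moreover obtain k' where "k' < N + p" "{b. (k - p) + b \<in> S} = {b. k' + b \<in> S}"
        using less[of "k - p"] False p(1) by auto
      ultimately show ?thesis by blast
    qed blast
  qed
  with that show thesis by blast
qed

section \<open>Soficity of gap shifts with eventually periodic gap set\<close>

lemma finite_image_factor:
  assumes "finite (k ` A)" "\<And>x y. x \<in> A \<Longrightarrow> y \<in> A \<Longrightarrow> k x = k y \<Longrightarrow> f x = f y"
  shows "finite (f ` A)"
proof -
  have "f x = f (inv_into A k (k x))" if "x \<in> A" for x
    using assms(2)[OF that, of "inv_into A k (k x)"] that
    by (simp add: f_inv_into_f inv_into_into)
  then have "f ` A \<subseteq> (\<lambda>c. f (inv_into A k c)) ` k ` A" by auto
  then show ?thesis using assms(1) finite_subset by blast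
qed

lemma join_rays_eq_glue: "join_rays (left_ray x) (right_ray y) = glue 0 x y"
  by (auto simp: join_rays_def left_ray_def right_ray_def glue_def fun_eq_iff)

lemma letters_map_Some [simp]: "letters (map Some w) = w"
  by (induction w) simp_all

text \<open>A configuration without stars is its own sequence of letters, so the gluing criterion
  becomes available for the gap shift itself.\<close>

lemma gap_shift_iff_star_gap:
  assumes "S \<noteq> {}"
  shows "y \<in> gap_shift S \<longleftrightarrow> (\<lambda>i. Some (y i)) \<in> star_gap S"
proof -
  have "y i \<in> {0, 1}" if w: "\<And>i n. word_at y i n \<in> gap_words S" for i
  proof -
    obtain ns where "sublist (word_at y i (Suc 0)) (blocks ns)"
      using w[of i "Suc 0"] unfolding gap_words_def by blast
    then have "set (word_at y i (Suc 0)) \<subseteq> {0, 1}" using set_mono_sublist set_blocks by blast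
    then show ?thesis by (simp add: word_at_Suc)
  qed
  then show ?thesis
    unfolding star_studded_iff word_at_compose letters_map_Some language_gap_shift[OF assms]
    by (auto simp: gap_shift_def star_alphabet_def)
qed

text \<open>By \<open>glue_iff\<close> a past matters only through the right counts that it allows.
  These form everything or a translate of \<open>S\<close>, and eventual periodicity leaves finitely
  many translates.\<close>

lemma sofic_gap_shift_infinite:
  assumes "infinite S" "eventually_periodic S"
  shows "sofic (gap_shift S)"
proof -
  have ne: "S \<noteq> {}" using assms by auto
  let ?s = "\<lambda>y :: int \<Rightarrow> nat. \<lambda>i. Some (y i)"
  let ?G = "gap_shift S"
  let ?T = "\<lambda>y. {b. \<forall>a\<in>left_counts (?s y) 0. a + b \<in> S}"
  obtain M where M: "\<And>k. \<exists>k'<M. {b. k + b \<in> S} = {b. k' + b \<in> S}"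
    using eventually_periodic_tails[OF assms(2)] by blast
  have followers: "followers_ray ?G (left_ray y) =
      {r. \<exists>z\<in>?G. r = right_ray z \<and> right_counts (?s z) 0 \<subseteq> ?T y}" if y: "y \<in> ?G" for y
  proof -
    have "join_rays (left_ray y) (right_ray z) \<in> ?G \<longleftrightarrow> right_counts (?s z) 0 \<subseteq> ?T y"
      if "z \<in> ?G" for z
    proof -
      have "(\<lambda>i. Some (glue 0 y z i)) = glue 0 (?s y) (?s z)" by (auto simp: glue_def)
      then have "join_rays (left_ray y) (right_ray z) \<in> ?G \<longleftrightarrow> glue 0 (?s y) (?s z) \<in> star_gap S"
        unfolding gap_shift_iff_star_gap[OF ne] join_rays_eq_glue by simp
      also have "\<dots> \<longleftrightarrow> right_counts (?s z) 0 \<subseteq> ?T y"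
        using y that unfolding gap_shift_iff_star_gap[OF ne]
        by (subst glue_iff[OF assms(1)]) auto
      finally show ?thesis .
    qed
    then show ?thesis unfolding followers_ray_def by blast
  qed
  \<comment> \<open>\<open>UNIV\<close> is the value for a past without zeros.\<close>
  have T: "?T y \<in> insert UNIV ((\<lambda>k. {b. k + b \<in> S}) ` {..<M})" for y
  proof (rule left_counts_cases[of "?s y" 0])
    fix a assume "left_counts (?s y) 0 = {a}"
    then show ?thesis using M[of a] by auto
  qed simp
  then have "finite (?T ` ?G)"
    by (intro finite_subset[of "?T ` ?G" "insert UNIV ((\<lambda>k. {b. k + b \<in> S}) ` {..<M})"]) auto
  then have "finite ((\<lambda>y. followers_ray ?G (left_ray y)) ` ?G)"
    by (rule finite_image_factor) (simp add: followers)
  then show ?thesis by (simp add: sofic_def image_image)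
qed

text \<open>A run of ones cannot contain the zero that starts a block, so it lies inside a single
  block. For finite \<open>S\<close> this bounds all runs.\<close>

lemma sublist_blocks_run:
  assumes "sublist (replicate n 1) (blocks ns)" "0 < n"
  shows "\<exists>s\<in>set ns. n \<le> s"
  using assms
proof (induction ns)
  case (Cons m ns)
  then obtain p q where "0 # replicate m 1 @ blocks ns = p @ replicate n 1 @ q"
    by (auto simp: sublist_def)
  then obtain p' where p': "replicate m 1 @ blocks ns = p' @ replicate n 1 @ q"
    using Cons.prems(2) by (cases p; cases n) auto
  from p' consider us where "blocks ns = us @ replicate n 1 @ q"
    | us where "replicate m 1 = p' @ us" "us @ blocks ns = replicate n 1 @ q"
    by (auto simp: append_eq_append_conv2)
  then show ?case
  proof cases
    case 1
    then have "sublist (replicate n 1) (blocks ns)" by (metis sublist_appendI)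
    then show ?thesis using Cons by auto
  next
    case 2
    \<comment> \<open>Here the run starts inside the first block, with \<open>us\<close> the rest of
      that block. What follows \<open>us\<close> is empty or starts with 0, so the run is no longer
      than \<open>us\<close>.\<close>
    have us: "us = replicate (length us) 1"
      using 2(1) by (metis append_eq_conv_conj drop_replicate length_replicate)
    have le: "length us \<le> m" using arg_cong[OF 2(1), of length] by simp
    have *: "takeWhile (\<lambda>a. a = 1) (replicate k 1 @ blocks ns) = replicate k (1::nat)" for k
      by (cases ns) (simp_all add: takeWhile_append)
    have "length (takeWhile (\<lambda>a. a = 1) (us @ blocks ns)) = length us"
      using *[of "length us"] us by (metis length_replicate)
    moreover have "n \<le> length (takeWhile (\<lambda>a. a = 1) (replicate n (1::nat) @ q))"
      by (simp add: takeWhile_append)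
    ultimately show ?thesis using 2(2) le by auto
  qed
qed simp

lemma set_gap_words: "w \<in> gap_words S \<Longrightarrow> set w \<subseteq> {0, 1}"
  unfolding gap_words_def mem_Collect_eq using subset_trans[OF set_mono_sublist set_blocks] by blast

lemma gap_words_append_at_zero:
  assumes "u @ [0] \<in> gap_words S" "0 # v \<in> gap_words S"
  shows "u @ 0 # v \<in> gap_words S"
proof -
  obtain ns p q where ns: "set ns \<subseteq> S" "blocks ns = (p @ u) @ 0 # q"
    using assms(1) by (auto simp: gap_words_def sublist_def)
  obtain ns' p' q' where ns': "set ns' \<subseteq> S" "blocks ns' = p' @ 0 # (v @ q')"
    using assms(2) by (auto simp: gap_words_def sublist_def)
  obtain ms where ms: "set ms \<subseteq> S" "blocks ms = p @ u"
    using blocks_split_at_zero[OF ns(2)] ns(1) by (metis set_append le_sup_iff)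
  obtain ks where ks: "set ks \<subseteq> S" "blocks ks = 0 # (v @ q')"
    using blocks_split_at_zero[OF ns'(2)] ns'(1) by (metis set_append le_sup_iff)
  have "blocks (ms @ ks) = p @ (u @ 0 # v) @ q'" using ms ks by simp
  then have "sublist (u @ 0 # v) (blocks (ms @ ks))" by (metis sublist_appendI)
  moreover have "set (ms @ ks) \<subseteq> S" using ms ks by simp
  ultimately show ?thesis unfolding gap_words_def mem_Collect_eq by (intro exI conjI)
qed

lemma word_at_cong: "(\<And>k. i \<le> k \<Longrightarrow> k < i + int n \<Longrightarrow> x k = y k) \<Longrightarrow> word_at x i n = word_at y i n"
  by (auto simp: word_at_def)

lemma nth_word_at: "k < n \<Longrightarrow> word_at x i n ! k = x (i + int k)"
  by (simp add: word_at_def)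

lemma gap_shift_glue_at_zero:
  assumes "x \<in> gap_shift S" "y \<in> gap_shift S" "x m = 0" "y m = 0"
  shows "glue m x y \<in> gap_shift S"
  unfolding gap_shift_def
proof (intro CollectI allI)
  fix i n
  let ?z = "glue m x y"
  have X: "word_at x i n \<in> gap_words S" and Y: "word_at y i n \<in> gap_words S" for i n
    using assms by (auto simp: gap_shift_def)
  consider "i + int n \<le> m" | "m \<le> i" | "i < m" "m < i + int n" by linarith
  then show "word_at ?z i n \<in> gap_words S"
  proof cases
    case 1
    then have "word_at ?z i n = word_at x i n" by (intro word_at_cong) (simp add: glue_def)
    then show ?thesis using X by simp
  next
    case 2
    then have "word_at ?z i n = word_at y i n" by (intro word_at_cong) (simp add: glue_def)
    then show ?thesis using Y by simp
  next
    case 3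
    define k where "k = nat (m - i)"
    define l where "l = nat (i + int n - m - 1)"
    have n: "n = k + Suc l" and m: "m = i + int k" using 3 by (auto simp: k_def l_def)
    have "word_at ?z i k = word_at x i k" "word_at ?z m (Suc l) = word_at y m (Suc l)"
      by (intro word_at_cong; simp add: glue_def m)+
    then have "word_at ?z i n = word_at x i k @ 0 # word_at y (m + 1) l"
      using assms(4) unfolding n word_at_add by (simp add: word_at_Suc m)
    moreover have "word_at x i k @ [0] \<in> gap_words S"
      using X[of i "Suc k"] assms(3) by (simp add: word_at_Suc_snoc m)
    moreover have "0 # word_at y (m + 1) l \<in> gap_words S"
      using Y[of m "Suc l"] assms(4) by (simp add: word_at_Suc)
    ultimately show ?thesis using gap_words_append_at_zero by metis
  qed
qed

text \<open>All runs of ones are shorter than \<open>K\<close>, so every past has a zero among its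
  last \<open>Suc K\<close> cells, and these cells determine what may follow.\<close>

lemma sofic_gap_shift_finite:
  assumes "finite S"
  shows "sofic (gap_shift S)"
proof -
  let ?G = "gap_shift S"
  obtain K where K: "\<And>s. s \<in> S \<Longrightarrow> s < K" using assms finite_nat_set_iff_bounded by metis
  have words: "word_at y i n \<in> gap_words S" if "y \<in> ?G" for y i n
    using that unfolding gap_shift_def by blast
  note bin = set_gap_words[OF words]
  have zero: "\<exists>m. - int (Suc K) \<le> m \<and> m < 0 \<and> y m = 0" if y: "y \<in> ?G" for y
  proof (rule ccontr)
    assume n: "\<not> ?thesis"
    have "a = 1" if a: "a \<in> set (word_at y (- int (Suc K)) (Suc K))" for a
    proof -
      obtain k where "k < Suc K" "a = y (- int (Suc K) + int k)"
        using a by (auto simp: word_at_def simp del: upt_Suc)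
      then have "a \<noteq> 0" using n by (auto dest: spec[of _ "- int (Suc K) + int k"])
      then show ?thesis using bin[OF y] a by blast
    qed
    then have "word_at y (- int (Suc K)) (Suc K) = replicate (Suc K) 1"
      by (intro replicate_eqI) simp_all
    then have "replicate (Suc K) 1 \<in> gap_words S" using words[OF y] by metis
    then obtain ns where ns: "set ns \<subseteq> S" "sublist (replicate (Suc K) 1) (blocks ns)"
      unfolding gap_words_def by blast
    then obtain s where "s \<in> set ns" "Suc K \<le> s" using sublist_blocks_run by blast
    then show False using K[of s] ns(1) by auto
  qed
  let ?k = "\<lambda>y. word_at y (- int (Suc K)) (Suc K)"
  have sub: "followers_ray ?G (left_ray y) \<subseteq> followers_ray ?G (left_ray z)"
    if yz: "y \<in> ?G" "z \<in> ?G" "?k y = ?k z" for y z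
  proof -
    have e: "y i = z i" if "- int (Suc K) \<le> i" "i < 0" for i
    proof -
      have "?k y ! nat (i + int (Suc K)) = ?k z ! nat (i + int (Suc K))" using yz(3) by argo
      moreover have "?k x ! nat (i + int (Suc K)) = x i" for x :: "int \<Rightarrow> nat"
        using that by (simp add: nth_word_at)
      ultimately show ?thesis by metis
    qed
    obtain m where m: "- int (Suc K) \<le> m" "m < 0" "y m = 0" using zero[OF yz(1)] by blast
    have "glue 0 z w \<in> ?G" if w: "glue 0 y w \<in> ?G" for w
    proof -
      \<comment> \<open>The past of \<open>z\<close> is attached at the common zero
        \<open>m\<close>. As \<open>y\<close> and \<open>z\<close> agree from \<open>m\<close> to 0,
        this is the same as gluing \<open>z\<close> to \<open>w\<close> at 0.\<close>
      have "glue m z (glue 0 y w) \<in> ?G"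
        by (rule gap_shift_glue_at_zero) (use yz w m e[of m] in \<open>simp_all add: glue_def\<close>)
      moreover have "glue m z (glue 0 y w) = glue 0 z w"
        using m e by (auto simp: glue_def fun_eq_iff)
      ultimately show ?thesis by simp
    qed
    then show ?thesis by (auto simp: followers_ray_def join_rays_eq_glue)
  qed
  have "?k ` ?G \<subseteq> {w. set w \<subseteq> {0, 1} \<and> length w = Suc K}"
    using bin by (intro image_subsetI CollectI conjI length_word_at)
  then have "finite (?k ` ?G)" using finite_lists_length_eq[of "{0, 1}" "Suc K"] finite_subset by blast
  then have "finite ((\<lambda>y. followers_ray ?G (left_ray y)) ` ?G)"
    by (rule finite_image_factor) (intro subset_antisym sub; simp)
  then show ?thesis by (simp add: sofic_def image_image)
qed

lemma eventually_periodic_sofic: "eventually_periodic S \<Longrightarrow> sofic (gap_shift S)"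
  using sofic_gap_shift_finite sofic_gap_shift_infinite by blast

section \<open>Subshift, non-soficity and synchronization\<close>

lemma topspace_full_shift: "topspace (full_shift A) = {x. \<forall>i. x i \<in> A}"
  by (auto simp: full_shift_def PiE_iff)

text \<open>\<open>P\<close> depends on the cells in \<open>J\<close> only, so around each point the
  cylinder fixing these finitely many cells stays inside the set.\<close>

lemma openin_full_shift_local:
  assumes "finite J" "\<And>x y. (\<And>j. j \<in> J \<Longrightarrow> x j = y j) \<Longrightarrow> P x \<Longrightarrow> P y"
  shows "openin (full_shift A) {x. (\<forall>i. x i \<in> A) \<and> P x}"
  unfolding full_shift_def openin_product_topology_alt
proof (intro ballI)
  fix x assume "x \<in> {x. (\<forall>i. x i \<in> A) \<and> P x}"
  then have x: "\<And>i. x i \<in> A" "P x" by auto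
  let ?U = "\<lambda>j. if j \<in> J then {x j} else A"
  have "{i \<in> UNIV. ?U i \<noteq> topspace (discrete_topology A)} \<subseteq> J" by auto
  then have "finite {i \<in> UNIV. ?U i \<noteq> topspace (discrete_topology A)}"
    using assms(1) finite_subset by blast
  moreover have "\<forall>i\<in>UNIV. openin (discrete_topology A) (?U i)" using x by simp
  moreover have "x \<in> Pi\<^sub>E UNIV ?U" using x(1) by (simp add: PiE_iff)
  moreover have "Pi\<^sub>E UNIV ?U \<subseteq> {x. (\<forall>i. x i \<in> A) \<and> P x}"
  proof
    fix y assume y: "y \<in> Pi\<^sub>E UNIV ?U"
    then have *: "y i \<in> ?U i" for i using PiE_mem[OF y, of i] by simp
    have "y i \<in> A" for i using *[of i] x(1) by (auto split: if_splits)
    moreover have "x j = y j" if "j \<in> J" for j using *[of j] that by simp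
    then have "P y" using assms(2) x(2) by blast
    ultimately show "y \<in> {x. (\<forall>i. x i \<in> A) \<and> P x}" by simp
  qed
  ultimately show "\<exists>U. finite {i \<in> UNIV. U i \<noteq> topspace (discrete_topology A)} \<and>
      (\<forall>i\<in>UNIV. openin (discrete_topology A) (U i)) \<and> x \<in> Pi\<^sub>E UNIV U \<and>
      Pi\<^sub>E UNIV U \<subseteq> {x. (\<forall>i. x i \<in> A) \<and> P x}" by (intro exI[of _ ?U] conjI)
qed

lemma closedin_avoiding: "closedin (full_shift A) (avoiding A \<F>)"
proof -
  have "topspace (full_shift A) - avoiding A \<F> =
      \<Union>((\<lambda>(w, i). {x. (\<forall>k. x k \<in> A) \<and> word_at x i (length w) = w}) ` (\<F> \<times> UNIV))"
    by (auto simp: topspace_full_shift avoiding_def)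
  moreover have "openin (full_shift A) {x. (\<forall>k. x k \<in> A) \<and> word_at x i (length w) = w}" for w i
  proof (rule openin_full_shift_local[of "{i..<i + int (length w)}"])
    fix x y :: "int \<Rightarrow> 'a"
    assume "\<And>j. j \<in> {i..<i + int (length w)} \<Longrightarrow> x j = y j" "word_at x i (length w) = w"
    then show "word_at y i (length w) = w" using word_at_cong[of i "length w" x y] by simp
  qed simp
  ultimately have "openin (full_shift A) (topspace (full_shift A) - avoiding A \<F>)"
    by (auto intro!: openin_Union)
  moreover have "avoiding A \<F> \<subseteq> topspace (full_shift A)"
    by (auto simp: topspace_full_shift avoiding_def)
  ultimately show ?thesis by (simp add: closedin_def)
qed

lemma subshift_star_gap:
  assumes "infinite S"
  shows "subshift (star_alphabet {0, 1}) (star_gap S)"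
  unfolding subshift_def
proof (intro conjI)
  show "finite (star_alphabet {0, 1 :: nat})" by (simp add: star_alphabet_def)
  show "star_gap S \<noteq> {}" using all_ones_in_star_gap[OF assms] by blast
  show "closedin (full_shift (star_alphabet {0, 1})) (star_gap S)"
    unfolding star_studded_def star_avoiding_def by (rule closedin_avoiding)
  show "shift 1 ` star_gap S = star_gap S"
  proof
    show "star_gap S \<subseteq> shift 1 ` star_gap S"
    proof
      fix x assume "x \<in> star_gap S"
      then show "x \<in> shift 1 ` star_gap S"
        by (intro image_eqI[of _ _ "shift (-1) x"] star_studded_shift) simp_all
    qed
  qed (auto intro: star_studded_shift)
qed

text \<open>Pasts with their single zero at \<open>- a - 1\<close> are told apart by futures with a
  single zero at \<open>b\<close>, which fit exactly if \<open>a + b\<close> is in \<open>S\<close>.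
  Two equal follower sets would make \<open>S\<close> eventually periodic.\<close>

lemma not_sofic_star_gap:
  assumes S: "\<not> eventually_periodic S"
  shows "\<not> sofic (star_gap S)"
proof
  assume "sofic (star_gap S)"
  then have fin: "finite (followers_ray (star_gap S) ` left_ray ` star_gap S)"
    by (simp add: sofic_def)
  have inf: "infinite S" using S finite_eventually_periodic by blast
  let ?l = "\<lambda>a. left_ray (zero_at (- int a - 1))"
  have mem: "right_ray (zero_at (int b)) \<in> followers_ray (star_gap S) (?l a) \<longleftrightarrow> a + b \<in> S" for a b
    unfolding followers_ray_def
    by (simp add: join_rays_eq_glue glue_zero_at_iff inf zero_at_in_star_gap left_counts_zero_at)
  have "inj (\<lambda>a. followers_ray (star_gap S) (?l a))"
  proof (rule injI, rule ccontr)
    fix a c assume e: "followers_ray (star_gap S) (?l a) = followers_ray (star_gap S) (?l c)" "a \<noteq> c"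
    have "a + b \<in> S \<longleftrightarrow> c + b \<in> S" for b unfolding mem[symmetric] e(1) ..
    then show False using eventually_periodicI[of 0 a S c] e(2) S by blast
  qed
  moreover have "range (\<lambda>a. followers_ray (star_gap S) (?l a)) \<subseteq>
      followers_ray (star_gap S) ` left_ray ` star_gap S"
    using zero_at_in_star_gap[OF inf] by blast
  ultimately show False using fin finite_subset range_inj_infinite by blast
qed

lemma glue_same: "glue m x x = x"
  by (simp add: glue_def)

text \<open>A zero just before the seam makes the left count 0 and rules out a star there, so
  nothing further back influences what may follow.\<close>

lemma synchronizing_star_gap:
  assumes S: "infinite S"
  shows "synchronizing (star_gap S) [Some 0]"
  unfolding synchronizing_def
proof (intro conjI ballI impI)
  have "word_at (zero_at 0) 0 (Suc 0) = [Some 0]" by (simp add: word_at_Suc zero_at_def)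
  then show "[Some 0] \<in> language (star_gap S)"
    using word_at_in_language[OF zero_at_in_star_gap[OF S]] by metis
  have lc: "left_counts z 0 = {0}" if "z (-1) = Some 0" for z
    using left_counts_eqI[of "-1" 0 z] that by (simp add: no_zero_def ones_def)
  fix l assume "l \<in> left_ray ` star_gap S" and l: "\<forall>k<length [Some 0 :: nat option]. l k = rev [Some 0] ! k"
  then obtain x where x: "x \<in> star_gap S" "l = left_ray x" by blast
  have x1: "x (-1) = Some 0" using l x(2) by (auto simp: left_ray_def)
  show "followers_ray (star_gap S) l = followers_word (star_gap S) [Some 0]"
  proof
    show "followers_ray (star_gap S) l \<subseteq> followers_word (star_gap S) [Some 0]"
    proof
      fix r assume "r \<in> followers_ray (star_gap S) l"
      then obtain z where z: "r = right_ray z" "z \<in> star_gap S" "glue 0 x z \<in> star_gap S"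
        unfolding followers_ray_def x(2) by (auto simp: join_rays_eq_glue)
      have "prepend [Some 0] r = right_ray (shift (-1) (glue 0 x z))"
        using x1 by (auto simp: prepend_def z(1) right_ray_def shift_def glue_def fun_eq_iff of_nat_diff)
      then show "r \<in> followers_word (star_gap S) [Some 0]"
        unfolding followers_word_def using star_studded_shift[OF z(3), of "-1"] z by blast
    qed
    show "followers_word (star_gap S) [Some 0] \<subseteq> followers_ray (star_gap S) l"
    proof
      fix r assume "r \<in> followers_word (star_gap S) [Some 0]"
      then obtain z where z: "z \<in> star_gap S" "prepend [Some 0] r = right_ray z"
        and r: "r \<in> right_ray ` star_gap S"
        unfolding followers_word_def by blast
      \<comment> \<open>\<open>z\<close> has the zero at cell 0; the shift brings it to -1, and
        \<open>r\<close> then starts at 0.\<close>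
      define y where "y = shift 1 z"
      have y: "y \<in> star_gap S" unfolding y_def using z(1) by (rule star_studded_shift)
      have ry: "r = right_ray y"
      proof
        fix n
        have "prepend [Some 0] r (Suc n) = right_ray z (Suc n)" using z(2) by simp
        then show "r n = right_ray y n"
          by (simp add: prepend_def y_def right_ray_def shift_def add.commute)
      qed
      have "y (-1) = Some 0" using fun_cong[OF z(2), of 0]
        by (simp add: prepend_def y_def right_ray_def shift_def)
      \<comment> \<open>Gluing \<open>y\<close> to itself gives \<open>y\<close>, so the criterion
        read backwards puts its right count in \<open>S\<close>.\<close>
      with lc y have c: "\<forall>b\<in>right_counts y 0. b \<in> S"
        using glue_iff[OF S y y, of 0] by (simp add: glue_same)
      have "glue 0 x y \<in> star_gap S"
        unfolding glue_iff[OF S x(1) y] using c x1 lc[of x, OF x1] by simp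
      then show "r \<in> followers_ray (star_gap S) l"
        unfolding followers_ray_def using r ry x(2) by (simp add: join_rays_eq_glue)
    qed
  qed
qed

lemma ones_shift: "ones (shift p x) i j = ones x (i + p) (j + p)"
proof -
  have "{k \<in> {i + p..<j + p}. x k = Some 1} = (\<lambda>k. k + p) ` {k \<in> {i..<j}. shift p x k = Some 1}"
  proof (intro equalityI subsetI)
    fix k assume "k \<in> {k \<in> {i + p..<j + p}. x k = Some 1}"
    then show "k \<in> (\<lambda>k. k + p) ` {k \<in> {i..<j}. shift p x k = Some 1}"
      by (intro image_eqI[of _ _ "k - p"]) (auto simp: shift_def)
  qed (auto simp: shift_def)
  then show ?thesis by (simp add: ones_def card_image)
qed

lemma no_zero_shift: "no_zero (shift p x) i j \<longleftrightarrow> no_zero x (i + p) (j + p)"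
proof
  assume *: "no_zero (shift p x) i j"
  show "no_zero x (i + p) (j + p)"
    unfolding no_zero_def
  proof
    fix k assume "k \<in> {i + p..<j + p}"
    then have "shift p x (k - p) \<noteq> Some 0" using * by (auto simp: no_zero_def)
    then show "x k \<noteq> Some 0" by (simp add: shift_def)
  qed
qed (auto simp: no_zero_def shift_def)

lemma right_counts_subset: obtains c where "right_counts x m \<subseteq> {c}"
proof (cases "right_counts x m = {}")
  case False
  then obtain i where "m \<le> i" "x i = Some 0" "no_zero x m i"
    by (auto simp: right_counts_def)
  from right_counts_eqI[OF this] that show thesis by blast
qed (use that in blast)

lemma left_counts_subset: obtains c where "left_counts x m \<subseteq> {c}"
  by (rule left_counts_cases[of x m]) (use that in blast)+

lemma word_at_pad: "word_at (pad i (i + int n) x) i n = word_at x i n"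
  by (rule word_at_cong) (simp add: pad_def)

text \<open>Both words are surrounded by ones and put \<open>a\<close> ones apart. The only new gap
  has length \<open>b + a + c\<close>, and the infinite set \<open>S\<close> permits a choice of
  \<open>a\<close> that makes it legal.\<close>

lemma transitive_star_gap:
  assumes S: "infinite S"
  shows "transitive (star_gap S)"
  unfolding transitive_def
proof (intro ballI)
  fix u v assume "u \<in> language (star_gap S)" "v \<in> language (star_gap S)"
  then obtain x i n y j m where u: "x \<in> star_gap S" "u = word_at x i n"
    and v: "y \<in> star_gap S" "v = word_at y j m" unfolding language_def by blast
  define x1 where "x1 = pad 0 (int n) (shift i x)"
  define y1 where "y1 = pad 0 (int m) (shift j y)"
  have x1: "x1 \<in> star_gap S" "word_at x1 0 n = u" and y1: "y1 \<in> star_gap S" "word_at y1 0 m = v"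
    using word_at_pad[of 0 n "shift i x"] word_at_pad[of 0 m "shift j y"]
    by (simp_all add: x1_def y1_def u v pad_in_star_gap[OF S] star_studded_shift)
  obtain b where b: "left_counts x1 (int n) \<subseteq> {b}" by (rule left_counts_subset)
  obtain c where c: "right_counts y1 0 \<subseteq> {c}" by (rule right_counts_subset)
  \<comment> \<open>\<open>Suc\<close> makes \<open>a\<close> positive, so that a star ending
    \<open>u\<close> and a star starting \<open>v\<close> are kept apart as well.\<close>
  obtain s where s: "s \<in> S" "Suc (b + c) \<le> s" using infinite_nat_ge[OF S] by blast
  define a where "a = s - (b + c)"
  define y2 where "y2 = shift (- int n - int a) y1"
  have y2: "y2 \<in> star_gap S" unfolding y2_def by (rule star_studded_shift[OF y1(1)])
  have a: "0 < a" "b + (a + c) \<in> S" using s by (auto simp: a_def)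
  have gap: "y2 k = Some 1" if "k < int n + int a" for k
    using that by (simp add: y2_def y1_def shift_def pad_def)
  have "right_counts y2 (int n) \<subseteq> {a + c}"
  proof
    fix d assume "d \<in> right_counts y2 (int n)"
    then obtain k where k: "int n \<le> k" "y2 k = Some 0" "no_zero y2 (int n) k" "d = ones y2 (int n) k"
      by (auto simp: right_counts_def)
    have le: "int n + int a \<le> k" using k(2) gap[of k] by fastforce
    define l where "l = k - int n - int a"
    have "y1 l = Some 0" using k(2) by (simp add: y2_def shift_def l_def algebra_simps)
    moreover have "no_zero y2 (int n + int a) k"
      using k(3) no_zero_split[of "int n" "int n + int a" k] le by simp
    then have "no_zero y1 0 l" by (simp add: y2_def no_zero_shift l_def algebra_simps)
    ultimately have "ones y1 0 l \<in> right_counts y1 0"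
      using le by (auto simp: right_counts_def l_def)
    then have "ones y1 0 l = c" using c by blast
    moreover have "ones y2 (int n) (int n + int a) = a"
      using ones_all[of "int n" "int n + int a" y2] gap by simp
    moreover have "ones y2 (int n + int a) k = ones y1 0 l"
      by (simp add: y2_def ones_shift l_def algebra_simps)
    ultimately show "d \<in> {a + c}"
      using k(4) ones_split[of "int n" "int n + int a" k y2] le by simp
  qed
  then have "glue (int n) x1 y2 \<in> star_gap S"
    unfolding glue_iff[OF S x1(1) y2] using gap[of "int n"] a b by auto
  moreover have "word_at (glue (int n) x1 y2) 0 (n + (a + m)) = u @ word_at y2 (int n) a @ v"
  proof -
    have "word_at (glue (int n) x1 y2) 0 n = u"
      unfolding x1(2)[symmetric] by (rule word_at_cong) (simp add: glue_def)
    moreover have "word_at (glue (int n) x1 y2) (int n) a = word_at y2 (int n) a"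
      by (rule word_at_cong) (simp add: glue_def)
    moreover have "word_at (glue (int n) x1 y2) (int n + int a) m = word_at y2 (int n + int a) m"
      by (rule word_at_cong) (simp add: glue_def)
    moreover have "word_at y2 (int n + int a) m = v" using y1(2) by (simp add: y2_def)
    ultimately show ?thesis unfolding word_at_add by simp
  qed
  ultimately show "\<exists>w\<in>language (star_gap S). u @ w @ v \<in> language (star_gap S)"
    using word_at_in_language[OF y2] word_at_in_language by metis
qed

section \<open>The cellular automaton moving the stars\<close>

definition move_stars :: "(int \<Rightarrow> 'a option) \<Rightarrow> int \<Rightarrow> 'a option" where
  "move_stars x i = (if x i = None then x (i + 1) else if x (i - 1) = None then None else x i)"

definition move_stars_back :: "(int \<Rightarrow> 'a option) \<Rightarrow> int \<Rightarrow> 'a option" where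
  "move_stars_back x i = (if x i = None then x (i - 1) else if x (i + 1) = None then None else x i)"

lemma no_double_star:
  assumes "x \<in> star_studded A X" "x i = None"
  shows "x (i + 1) \<noteq> None" "x (i - 1) \<noteq> None"
proof -
  have *: "x j = None \<Longrightarrow> x (j + 1) \<noteq> None" for j
    using assms(1) unfolding star_studded_iff by blast
  show "x (i + 1) \<noteq> None" using * assms(2) by blast
  show "x (i - 1) \<noteq> None" using *[of "i - 1"] assms(2) by auto
qed

text \<open>\<open>\<phi> i\<close> is the cell of \<open>x\<close> at which the letters of
  \<open>y\<close> from cell \<open>i\<close> on begin. Consecutive cells of \<open>y\<close>
  account for consecutive stretches of \<open>x\<close>, so every word of \<open>y\<close> erases to
  an erased word of \<open>x\<close>.\<close>

lemma star_studded_transport: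
  assumes x: "x \<in> star_studded A X" and al: "\<And>i. y i \<in> star_alphabet A"
    and nn: "\<And>i. y i = None \<Longrightarrow> y (i + 1) \<noteq> None"
    and mono: "\<And>i. \<phi> i \<le> \<phi> (i + 1)"
    and step: "\<And>i. letters [y i] = letters (word_at x (\<phi> i) (nat (\<phi> (i + 1) - \<phi> i)))"
  shows "y \<in> star_studded A X"
proof -
  have "\<phi> i \<le> \<phi> (i + int n) \<and>
      letters (word_at y i n) = letters (word_at x (\<phi> i) (nat (\<phi> (i + int n) - \<phi> i)))" for i n
  proof (induction n)
    case (Suc n)
    define j where "j = i + int n"
    have le: "\<phi> i \<le> \<phi> j" "\<phi> j \<le> \<phi> (j + 1)" using Suc mono by (auto simp: j_def)
    have j: "i + int (Suc n) = j + 1" by (simp add: j_def)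
    have n: "nat (\<phi> (j + 1) - \<phi> i) = nat (\<phi> j - \<phi> i) + nat (\<phi> (j + 1) - \<phi> j)"
      and p: "\<phi> i + int (nat (\<phi> j - \<phi> i)) = \<phi> j" using le by auto
    have "letters (word_at y i (Suc n)) = letters (word_at x (\<phi> i) (nat (\<phi> j - \<phi> i))) @ letters [y j]"
      using Suc unfolding word_at_Suc_snoc letters_simps(4) by (simp add: j_def)
    then show ?case using le unfolding j step n word_at_add p letters_simps(4) by auto
  qed simp
  then show ?thesis using x al nn unfolding star_studded_iff by simp
qed

lemma move_stars_None:
  assumes "x \<in> star_studded A X"
  shows "move_stars x i = None \<longleftrightarrow> x (i - 1) = None"
  using no_double_star[OF assms, of i] by (auto simp: move_stars_def)

lemma move_stars_back_None:
  assumes "x \<in> star_studded A X"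
  shows "move_stars_back x i = None \<longleftrightarrow> x (i + 1) = None"
  using no_double_star[OF assms, of i] by (auto simp: move_stars_back_def)

lemma move_stars_in:
  assumes x: "x \<in> star_studded A X"
  shows "move_stars x \<in> star_studded A X"
\<comment> \<open>If there is a star at \<open>i - 1\<close>, the letter at \<open>i\<close> has
  moved left to its place, so the letters of the image from cell \<open>i\<close> on begin one cell
  later.\<close>
proof (rule star_studded_transport[OF x, where \<phi> = "\<lambda>i. if x (i - 1) = None then i + 1 else i"])
  fix i
  note nn = no_double_star[OF x]
  show "move_stars x i \<in> star_alphabet A"
    using x[unfolded star_studded_iff] by (simp add: move_stars_def star_alphabet_def)
  show "move_stars x (i + 1) \<noteq> None" if "move_stars x i = None"
    using that nn(1)[of "i - 1"] by (simp add: move_stars_None[OF x])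
  show "(if x (i - 1) = None then i + 1 else i) \<le> (if x (i + 1 - 1) = None then i + 1 + 1 else i + 1)"
    by simp
  consider "x i = None" | "x i \<noteq> None" "x (i - 1) = None" | "x i \<noteq> None" "x (i - 1) \<noteq> None" by blast
  then show "letters [move_stars x i] = letters (word_at x (if x (i - 1) = None then i + 1 else i)
      (nat ((if x (i + 1 - 1) = None then i + 1 + 1 else i + 1) -
            (if x (i - 1) = None then i + 1 else i))))"
  proof cases
    case 1
    then show ?thesis using nn[of i] by (simp add: move_stars_def word_at_Suc numeral_2_eq_2)
  next
    case 2 then show ?thesis by (auto simp: move_stars_def)
  next
    case 3 then show ?thesis by (auto simp: move_stars_def word_at_Suc One_nat_def)
  qed
qed

lemma move_stars_back_in:
  assumes x: "x \<in> star_studded A X"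
  shows "move_stars_back x \<in> star_studded A X"
\<comment> \<open>Mirror image: a star at \<open>i\<close> receives the letter from
  \<open>i - 1\<close>, so the letters of the image from cell \<open>i\<close> on begin
  there.\<close>
proof (rule star_studded_transport[OF x, where \<phi> = "\<lambda>i. if x i = None then i - 1 else i"])
  fix i
  note nn = no_double_star[OF x]
  show "move_stars_back x i \<in> star_alphabet A"
    using x[unfolded star_studded_iff] by (simp add: move_stars_back_def star_alphabet_def)
  show "move_stars_back x (i + 1) \<noteq> None" if "move_stars_back x i = None"
    using that nn(1)[of "i + 1"] by (simp add: move_stars_back_None[OF x])
  show "(if x i = None then i - 1 else i) \<le> (if x (i + 1) = None then i + 1 - 1 else i + 1)"
    by simp
  consider "x i = None" | "x i \<noteq> None" "x (i + 1) = None" | "x i \<noteq> None" "x (i + 1) \<noteq> None" by blast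
  then show "letters [move_stars_back x i] = letters (word_at x (if x i = None then i - 1 else i)
      (nat ((if x (i + 1) = None then i + 1 - 1 else i + 1) - (if x i = None then i - 1 else i))))"
  proof cases
    case 1
    then show ?thesis using nn[of i] by (cases "x (i - 1)") (auto simp: move_stars_back_def word_at_Suc numeral_2_eq_2)
  next
    case 2 then show ?thesis by (auto simp: move_stars_back_def)
  next
    case 3 then show ?thesis by (auto simp: move_stars_back_def word_at_Suc One_nat_def)
  qed
qed

lemma move_stars_back_move_stars:
  assumes x: "x \<in> star_studded A X"
  shows "move_stars_back (move_stars x) = x"
proof
  fix i
  show "move_stars_back (move_stars x) i = x i"
    unfolding move_stars_back_def[of "move_stars x"] move_stars_None[OF x]
    using no_double_star[OF x, of i] no_double_star[OF x, of "i - 1"] by (simp add: move_stars_def)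
qed

lemma move_stars_move_stars_back:
  assumes x: "x \<in> star_studded A X"
  shows "move_stars (move_stars_back x) = x"
proof
  fix i
  show "move_stars (move_stars_back x) i = x i"
    unfolding move_stars_def[of "move_stars_back x"] move_stars_back_None[OF x]
    using no_double_star[OF x, of i] no_double_star[OF x, of "i + 1"] by (simp add: move_stars_back_def)
qed

lemma reversible_move_stars: "reversible_ca (star_studded A X) move_stars"
  unfolding reversible_ca_def cellular_automaton_def
proof
  show "sliding_block_code (star_studded A X) (star_studded A X) move_stars"
    unfolding sliding_block_code_def
  proof (intro conjI exI)
    show "\<forall>x\<in>star_studded A X. \<forall>i. move_stars x i =
      (\<lambda>w. if w ! 1 = None then w ! 2 else if w ! 0 = None then None else w ! 1)
        (word_at x (i + -1) (nat (1 - -1 + 1)))"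
      by (simp add: move_stars_def nth_word_at add.commute)
  qed (auto intro: move_stars_in)
  show "bij_betw move_stars (star_studded A X) (star_studded A X)"
    by (rule bij_betw_byWitness[where f' = move_stars_back])
      (auto simp: move_stars_back_move_stars move_stars_move_stars_back move_stars_in move_stars_back_in)
qed

section \<open>Iterates of the automaton and sensitivity in every direction\<close>

lemma move_stars_pow_in: "x \<in> star_studded A X \<Longrightarrow> (move_stars ^^ n) x \<in> star_studded A X"
  by (induction n) (simp_all add: move_stars_in)

lemma move_stars_pow_None:
  "x \<in> star_studded A X \<Longrightarrow> (move_stars ^^ n) x i = None \<longleftrightarrow> x (i - int n) = None"
proof (induction n arbitrary: i)
  case (Suc n)
  have "(move_stars ^^ Suc n) x i = None \<longleftrightarrow> (move_stars ^^ n) x (i - 1) = None"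
    using move_stars_None[OF move_stars_pow_in[OF Suc.prems]] by simp
  also have "\<dots> \<longleftrightarrow> x (i - 1 - int n) = None" by (rule Suc.IH[OF Suc.prems])
  also have "i - 1 - int n = i - int (Suc n)" by simp
  finally show ?case .
qed simp

lemma shift_move_stars_pow_None:
  assumes "x \<in> star_studded A X"
  shows "((shift p \<circ> (move_stars ^^ q)) ^^ n) x \<in> star_studded A X \<and>
    (((shift p \<circ> (move_stars ^^ q)) ^^ n) x i = None \<longleftrightarrow> x (i + int n * (p - int q)) = None)"
proof -
  define F where "F = shift p \<circ> (move_stars ^^ q :: (int \<Rightarrow> 'a option) \<Rightarrow> _)"
  have F: "F z = shift p ((move_stars ^^ q) z)" for z by (simp add: F_def)
  have "(F ^^ n) x \<in> star_studded A X \<and> ((F ^^ n) x i = None \<longleftrightarrow> x (i + int n * (p - int q)) = None)"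
  proof (induction n arbitrary: i)
    case (Suc n)
    let ?y = "(F ^^ n) x"
    have y: "?y \<in> star_studded A X" using Suc by blast
    have "F ?y i = None \<longleftrightarrow> ?y (i + p - int q) = None"
      using move_stars_pow_None[OF y, of q "i + p"] unfolding F[of ?y] shift_def by (simp only: diff_add_eq)
    also have "\<dots> \<longleftrightarrow> x (i + int (Suc n) * (p - int q)) = None"
    proof -
      have "i + p - int q + int n * (p - int q) = i + int (Suc n) * (p - int q)"
        by (simp add: algebra_simps)
      then show ?thesis using Suc[of "i + p - int q"] by metis
    qed
    finally have "F ?y i = None \<longleftrightarrow> x (i + int (Suc n) * (p - int q)) = None" .
    moreover have "F ?y \<in> star_studded A X"
      unfolding F[of ?y] by (rule star_studded_shift[OF move_stars_pow_in[OF y]])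
    moreover have "(F ^^ Suc n) x = F ?y" by simp
    ultimately show ?case by metis
  qed (use assms in simp)
  then show ?thesis unfolding F_def .
qed

text \<open>The bounds on \<open>k\<close> leave at least one cell between the star and the window,
  so both neighbours of the star are ones. All zeros lie in the window, so no gap contains the
  star.\<close>

lemma star_gap_insert_star:
  assumes S: "infinite S" and x: "pad 0 j x \<in> star_gap S" and k: "k < -1 \<or> j < k" and j: "0 \<le> j"
  shows "(pad 0 j x)(k := None) \<in> star_gap S" (is "?y \<in> _")
proof -
  note xX = x[unfolded star_gap_iff[OF S]]
  have far: "pad 0 j x k = Some 1" "pad 0 j x (k + 1) = Some 1" "pad 0 j x (k - 1) = Some 1"
    using k j by (auto simp: pad_def)
  have zero: "0 \<le> i \<and> i < j" if "?y i = Some 0" for i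
    using that by (auto simp: pad_def split: if_splits)
  show ?thesis unfolding star_gap_iff[OF S]
  proof (intro conjI allI impI)
    fix i
    show "?y i = None \<or> ?y i = Some 0 \<or> ?y i = Some 1" using xX by simp
    show "?y (i + 1) \<noteq> None" if "?y i = None"
      using that xX far by (cases "i + 1 = k") (auto split: if_splits)
    fix l assume il: "i < l" "?y i = Some 0" "?y l = Some 0" "no_zero ?y (i + 1) l"
    have same: "?y m = pad 0 j x m" if "i \<le> m" "m \<le> l" for m
      using zero[OF il(2)] zero[OF il(3)] that k by auto
    have "no_zero ?y (i + 1) l = no_zero (pad 0 j x) (i + 1) l"
      by (rule no_zero_cong, rule same; simp)
    moreover have "ones ?y (i + 1) l = ones (pad 0 j x) (i + 1) l"
      by (rule ones_cong, rule same; simp)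
    moreover have "pad 0 j x i = Some 0" "pad 0 j x l = Some 0"
      using il same[of i] same[of l] by simp_all
    ultimately show "ones ?y (i + 1) l \<in> S" using il xX by simp
  qed
qed

lemma language_padE:
  assumes "infinite S" "w \<in> language (star_gap S)"
  obtains x where "pad 0 (int (length w)) x \<in> star_gap S" "word_at (pad 0 (int (length w)) x) 0 (length w) = w"
proof -
  obtain x i n where x: "x \<in> star_gap S" "w = word_at x i n"
    using assms(2) unfolding language_def by blast
  then have "word_at (pad 0 (int (length w)) (shift i x)) 0 (length w) = w"
    using word_at_pad[of 0 n "shift i x"] by simp
  with that[of "shift i x"] show thesis
    using pad_in_star_gap[OF assms(1) star_studded_shift[OF x(1)]] by blast
qed

text \<open>Whether cell \<open>t\<close> is a star at time \<open>n\<close> depends only on cell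
  \<open>k\<close> at time 0, which drifts away with speed \<open>p - q\<close>. Once
  \<open>k\<close> is outside \<open>w\<close>, a star inserted there changes a cell that was
  supposed to be fixed.\<close>

lemma not_blocking_off_star_direction:
  assumes S: "infinite S" and pq: "p \<noteq> int q"
  shows "\<not> blocking_word r (star_gap S) (shift p \<circ> (move_stars ^^ q)) w"
proof
  let ?F = "shift p \<circ> (move_stars ^^ q)"
  assume "blocking_word r (star_gap S) ?F w"
  then obtain e t where w: "w \<in> language (star_gap S)" and e: "r + 1 \<le> e" "e \<le> length w" "t \<le> length w - e"
    and b: "\<And>x y n. x \<in> star_gap S \<Longrightarrow> y \<in> star_gap S \<Longrightarrow> word_at x 0 (length w) = w \<Longrightarrow>
      word_at y 0 (length w) = w \<Longrightarrow> word_at ((?F ^^ n) x) (int t) e = word_at ((?F ^^ n) y) (int t) e"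
    unfolding blocking_word_def by blast
  obtain x0 where x0: "pad 0 (int (length w)) x0 \<in> star_gap S"
    "word_at (pad 0 (int (length w)) x0) 0 (length w) = w"
    using language_padE[OF S w] by blast
  let ?x = "pad 0 (int (length w)) x0"
  \<comment> \<open>The integer \<open>p - q\<close> is nonzero, so this many steps carry
    \<open>k\<close> beyond \<open>length w\<close> or below -1, according to its sign.\<close>
  define n where "n = length w + t + 2"
  define k where "k = int t + int n * (p - int q)"
  have n: "int n = int (length w) + int t + 2" by (simp add: n_def)
  have k: "k < -1 \<or> int (length w) < k"
  proof (cases "p > int q")
    case True
    then have "int n * 1 \<le> int n * (p - int q)" by (intro mult_left_mono) auto
    then show ?thesis unfolding k_def using n by linarith
  next
    case False
    with pq have "int n * (p - int q) \<le> int n * (-1)" by (intro mult_left_mono) auto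
    then show ?thesis unfolding k_def using n by linarith
  qed
  let ?y = "?x(k := None)"
  have y: "?y \<in> star_gap S" by (rule star_gap_insert_star[OF S x0(1) k]) simp
  have "word_at ?y 0 (length w) = word_at ?x 0 (length w)"
    by (rule word_at_cong) (use k in auto)
  then have "word_at ?y 0 (length w) = w" using x0(2) by simp
  from b[OF x0(1) y x0(2) this, of n] have "word_at ((?F ^^ n) ?x) (int t) e ! 0 = word_at ((?F ^^ n) ?y) (int t) e ! 0"
    by argo
  then have "(?F ^^ n) ?x (int t) = (?F ^^ n) ?y (int t)" using e(1) by (simp add: nth_word_at)
  moreover have "(?F ^^ n) ?x (int t) = None \<longleftrightarrow> ?x k = None"
    using shift_move_stars_pow_None[OF x0(1)] unfolding k_def by blast
  moreover have "(?F ^^ n) ?y (int t) = None \<longleftrightarrow> ?y k = None"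
    using shift_move_stars_pow_None[OF y] unfolding k_def by blast
  moreover have "?x k = Some 1" using k by (auto simp: pad_def)
  ultimately show False by simp
qed

text \<open>In the frame moving with the stars, that is under
  \<open>shift 1 \<circ> move_stars\<close>, each letter is replaced by the letter at this
  cell.\<close>

definition next_letter :: "(int \<Rightarrow> 'a option) \<Rightarrow> int \<Rightarrow> int" where
  "next_letter x i = (if x (i + 1) = None then i + 2 else i + 1)"

lemma next_letter_pow:
  assumes x: "x \<in> star_studded A X" and i: "x i \<noteq> None"
  shows "x ((next_letter x ^^ n) i) \<noteq> None" "i + int n \<le> (next_letter x ^^ n) i"
proof -
  have "x ((next_letter x ^^ n) i) \<noteq> None \<and> i + int n \<le> (next_letter x ^^ n) i"
  proof (induction n)
    case (Suc n)
    define j where "j = (next_letter x ^^ n) i"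
    have "x (next_letter x j) \<noteq> None" "j + 1 \<le> next_letter x j"
      using no_double_star(1)[OF x, of "j + 1"] by (auto simp: next_letter_def add.assoc)
    then show ?case using Suc by (simp add: j_def)
  qed (use i in simp)
  then show "x ((next_letter x ^^ n) i) \<noteq> None" "i + int n \<le> (next_letter x ^^ n) i" by blast+
qed

text \<open>The stars stand still in this frame, so \<open>next_letter\<close> is the same at all
  times and the letters flow along its orbits.\<close>

lemma shift_move_stars_pow:
  assumes "x \<in> star_studded A X" "x i \<noteq> None"
  shows "((shift 1 \<circ> move_stars) ^^ n) x i = x ((next_letter x ^^ n) i)"
  using assms
proof (induction n arbitrary: x)
  case (Suc n)
  let ?H = "shift 1 \<circ> move_stars"
  have HX: "?H x \<in> star_studded A X" using Suc.prems by (simp add: star_studded_shift move_stars_in)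
  have N: "?H x j = None \<longleftrightarrow> x j = None" for j
    using move_stars_None[OF Suc.prems(1)] by (simp add: shift_def)
  have nl: "next_letter (?H x) = next_letter x" unfolding next_letter_def N ..
  have H: "?H x j = x (next_letter x j)" if "x j \<noteq> None" for j
    using that by (auto simp: shift_def move_stars_def next_letter_def add.assoc)
  have "(?H ^^ Suc n) x i = (?H ^^ n) (?H x) i" by (simp add: funpow_swap1)
  also have "\<dots> = ?H x ((next_letter x ^^ n) i)"
    using Suc.IH[OF HX] Suc.prems(2) N nl by metis
  also have "\<dots> = x ((next_letter x ^^ Suc n) i)"
    using H[OF next_letter_pow(1)[OF Suc.prems]] by simp
  finally show ?case .
qed simp

text \<open>Two points with a 1 at cell 0 have different images there, depending on cell 1. A radius
  of at least 1 gives the fixed part of a blocking word two cells, one of which carries a letter; a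
  lone cell could be a star, which stays put forever.\<close>

lemma not_radius_0_shift_move_stars:
  assumes S: "infinite S"
  shows "\<not> radius_ca 0 (star_gap S) (shift 1 \<circ> move_stars)"
proof
  assume "radius_ca 0 (star_gap S) (shift 1 \<circ> move_stars)"
  then obtain f where f: "\<And>x i. x \<in> star_gap S \<Longrightarrow> (shift 1 \<circ> move_stars) x i = f (word_at x i (Suc 0))"
    unfolding radius_ca_def by (auto simp: One_nat_def)
  show False
    using f[OF all_ones_in_star_gap[OF S], of 0] f[OF zero_at_in_star_gap[OF S, of 1], of 0]
    by (simp add: word_at_Suc zero_at_def shift_def move_stars_def)
qed

lemma glue_far_zero:
  assumes S: "infinite S" and x: "x \<in> star_gap S"
  obtains k where "b \<le> k" "m \<le> k" "glue m x (zero_at k) \<in> star_gap S"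
proof -
  obtain a where a: "left_counts x m \<subseteq> {a}" by (rule left_counts_subset)
  obtain s where s: "s \<in> S" "a + nat (b - m) + 1 \<le> s" using infinite_nat_ge[OF S] by blast
  define k where "k = m + int (s - a)"
  have k: "b \<le> k" "m < k" using s by (auto simp: k_def)
  have "no_zero (zero_at k) m k" by (simp add: no_zero_def zero_at_def)
  moreover have "ones (zero_at k) m k = s - a"
    using ones_all[of m k "zero_at k"] by (simp add: zero_at_def k_def)
  ultimately have "right_counts (zero_at k) m = {s - a}"
    using right_counts_eqI[of m k "zero_at k"] k by (simp add: zero_at_def)
  then have "glue m x (zero_at k) \<in> star_gap S"
    unfolding glue_iff[OF S x zero_at_in_star_gap[OF S]] using a s k by (auto simp: zero_at_def)
  with that k show thesis by force
qed

text \<open>Letters flow through a non-star cell of the fixed part. Changing a single one far to the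
  right into a zero keeps \<open>w\<close> and all stars, and the zero reaches that cell after
  finitely many steps.\<close>

lemma not_blocking_star_direction:
  assumes S: "infinite S" and rad: "radius_ca r (star_gap S) (shift 1 \<circ> move_stars)"
  shows "\<not> blocking_word r (star_gap S) (shift 1 \<circ> move_stars) w"
proof
  let ?F = "shift 1 \<circ> move_stars"
  assume "blocking_word r (star_gap S) ?F w"
  then obtain e t where w: "w \<in> language (star_gap S)" and e: "r + 1 \<le> e" "e \<le> length w" "t \<le> length w - e"
    and b: "\<And>x y n. x \<in> star_gap S \<Longrightarrow> y \<in> star_gap S \<Longrightarrow> word_at x 0 (length w) = w \<Longrightarrow>
      word_at y 0 (length w) = w \<Longrightarrow> word_at ((?F ^^ n) x) (int t) e = word_at ((?F ^^ n) y) (int t) e"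
    unfolding blocking_word_def by blast
  obtain x0 where x0: "pad 0 (int (length w)) x0 \<in> star_gap S"
    "word_at (pad 0 (int (length w)) x0) 0 (length w) = w"
    using language_padE[OF S w] by blast
  let ?L = "length w"
  let ?x = "pad 0 (int ?L) x0"
  have "r \<noteq> 0" using rad not_radius_0_shift_move_stars[OF S] by metis
  then have e2: "2 \<le> e" using e by simp
  obtain d where d: "d < e" "?x (int t + int d) \<noteq> None"
  proof (cases "?x (int t) = None")
    case True
    then have "?x (int t + int 1) \<noteq> None" using no_double_star(1)[OF x0(1)] by simp
    then show thesis using that[of 1] e2 by simp
  next
    case False
    then show thesis using that[of 0] e2 by simp
  qed
  define i where "i = int t + int d"
  \<comment> \<open>Each step along the letters advances by at least one cell, so
    \<open>length w\<close> steps lead out of the window. Beyond it there are no stars, the steps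
    have length one, and the orbit meets every later cell, in particular \<open>k\<close>.\<close>
  define k0 where "k0 = (next_letter ?x ^^ ?L) i"
  have k0: "int ?L \<le> k0" using next_letter_pow(2)[OF x0(1), of i ?L] d(2) by (simp add: k0_def i_def)
  obtain k where k: "k0 \<le> k" "int ?L \<le> k" "glue (int ?L) ?x (zero_at k) \<in> star_gap S"
    using glue_far_zero[OF S x0(1)] by metis
  let ?y = "glue (int ?L) ?x (zero_at k)"
  have none: "?y j = None \<longleftrightarrow> ?x j = None" for j
    by (simp add: glue_def zero_at_def pad_def)
  have "(next_letter ?x ^^ (m + ?L)) i = k0 + int m" for m
  proof (induction m)
    case (Suc m)
    have "?x (k0 + int m + 1) \<noteq> None" using k0 by (simp add: pad_def)
    then show ?case using Suc by (simp add: next_letter_def)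
  qed (simp add: k0_def)
  from this[of "nat (k - k0)"] have nk: "(next_letter ?x ^^ (nat (k - k0) + ?L)) i = k"
    using k by simp
  define n where "n = nat (k - k0) + ?L"
  have nl: "next_letter ?y = next_letter ?x" unfolding next_letter_def none ..
  have "word_at ?y 0 ?L = word_at ?x 0 ?L" by (rule word_at_cong) (simp add: glue_def)
  then have "word_at ?y 0 ?L = w" using x0(2) by simp
  from b[OF x0(1) k(3) x0(2) this, of n]
  have "word_at ((?F ^^ n) ?x) (int t) e ! d = word_at ((?F ^^ n) ?y) (int t) e ! d" by argo
  then have "(?F ^^ n) ?x i = (?F ^^ n) ?y i" unfolding nth_word_at[OF d(1)] i_def .
  moreover have "(?F ^^ n) ?x i = ?x ((next_letter ?x ^^ n) i)"
    by (rule shift_move_stars_pow[OF x0(1)]) (unfold i_def, rule d(2))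
  moreover have "(?F ^^ n) ?y i = ?y ((next_letter ?y ^^ n) i)"
    by (rule shift_move_stars_pow[OF k(3)]) (unfold none i_def, rule d(2))
  ultimately have "?x k = ?y k" unfolding nl nk[folded n_def] by simp
  then show False using k(2) by (simp add: glue_def zero_at_def pad_def)
qed

lemma all_directions_sensitive_move_stars:
  assumes S: "infinite S"
  shows "all_directions_sensitive (star_gap S) move_stars"
  unfolding all_directions_sensitive_def sensitive_def almost_equicontinuous_def
proof (intro allI impI notI)
  fix p :: int and q :: nat
  assume q: "coprime p (int q)"
    and "\<exists>r w. radius_ca r (star_gap S) (shift p \<circ> (move_stars ^^ q)) \<and>
      blocking_word r (star_gap S) (shift p \<circ> (move_stars ^^ q)) w"
  then obtain r w where rw: "radius_ca r (star_gap S) (shift p \<circ> (move_stars ^^ q))"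
    "blocking_word r (star_gap S) (shift p \<circ> (move_stars ^^ q)) w" by blast
  then have "p = int q" using not_blocking_off_star_direction[OF S] by blast
  \<comment> \<open>A number coprime to itself is 1, so the frame of the stars is the only direction
    left.\<close>
  moreover from this q have "q = Suc 0" by simp
  ultimately show False using rw not_blocking_star_direction[OF S] by simp
qed

section \<open>Direct primeness\<close>

lemma eventually_periodic_multiple:
  fixes n k p :: nat
  assumes "\<And>n. n \<ge> N \<Longrightarrow> n \<in> A \<longleftrightarrow> n + p \<in> A" "n \<ge> N"
  shows "n \<in> A \<longleftrightarrow> n + k * p \<in> A"
proof (induction k)
  case (Suc k)
  have "n + k * p \<in> A \<longleftrightarrow> n + k * p + p \<in> A" by (rule assms(1)) (use assms(2) in simp)
  then show ?case using Suc by (simp add: algebra_simps)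
qed simp

text \<open>The product of the two periods is a common period.\<close>

lemma eventually_periodic_inter:
  assumes A: "eventually_periodic A" and B: "eventually_periodic B"
    and S: "\<And>n. n \<ge> K \<Longrightarrow> n \<in> S \<longleftrightarrow> n \<in> A \<and> n \<in> B"
  shows "eventually_periodic S"
proof -
  obtain M p where p: "p > 0" "\<And>n. n \<ge> M \<Longrightarrow> n \<in> A \<longleftrightarrow> n + p \<in> A"
    using A unfolding eventually_periodic_def by blast
  obtain N q where q: "q > 0" "\<And>n. n \<ge> N \<Longrightarrow> n \<in> B \<longleftrightarrow> n + q \<in> B"
    using B unfolding eventually_periodic_def by blast
  have "n \<in> S \<longleftrightarrow> n + p * q \<in> S" if n: "n \<ge> M + N + K" for n
  proof -
    have "n \<in> A \<longleftrightarrow> n + q * p \<in> A" by (rule eventually_periodic_multiple[OF p(2)]) (use n in auto)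
    moreover have "n \<in> B \<longleftrightarrow> n + p * q \<in> B" by (rule eventually_periodic_multiple[OF q(2)]) (use n in auto)
    moreover have "n \<in> S \<longleftrightarrow> n \<in> A \<and> n \<in> B" "n + p * q \<in> S \<longleftrightarrow> n + p * q \<in> A \<and> n + p * q \<in> B"
      by (rule S, use n in simp)+
    ultimately show ?thesis by (metis mult.commute)
  qed
  moreover have "p * q > 0" using p q by simp
  ultimately show ?thesis unfolding eventually_periodic_def by blast
qed

section \<open>Joining halves in the components of a product\<close>

lemma shift_zero_at: "shift p (zero_at a) = zero_at (a - p)"
  by (auto simp: shift_def zero_at_def)

lemma shift_glue: "shift p (glue m x y) = glue (m - p) (shift p x) (shift p y)"
  by (auto simp: shift_def glue_def)

lemma shift_all_ones [simp]: "shift p all_ones = all_ones"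
  by (simp add: shift_def)

lemma left_counts_cong:
  assumes "\<And>k. k < m \<Longrightarrow> x k = y k"
  shows "left_counts x m = left_counts y m"
proof -
  have "i < m \<and> x i = Some 0 \<and> no_zero x (i + 1) m \<longleftrightarrow> i < m \<and> y i = Some 0 \<and> no_zero y (i + 1) m" for i
    using assms no_zero_cong[of "i + 1" m x y] by auto
  moreover have "ones x (i + 1) m = ones y (i + 1) m" for i by (rule ones_cong) (rule assms)
  ultimately show ?thesis unfolding left_counts_def by simp
qed

text \<open>The content sits on the left of the seam at 0. \<open>K\<close> is a margin of ones
  around the seam, within which a map of small radius cannot tell the point from
  \<open>all_ones\<close>.\<close>

definition left_point :: "nat set \<Rightarrow> nat \<Rightarrow> (int \<Rightarrow> nat option) \<Rightarrow> bool" where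
  "left_point S K x \<longleftrightarrow> x \<in> star_gap S \<and> (\<forall>i\<ge>- int K. x i = Some 1)"

definition right_point :: "nat set \<Rightarrow> nat \<Rightarrow> (int \<Rightarrow> nat option) \<Rightarrow> bool" where
  "right_point S K x \<longleftrightarrow> x \<in> star_gap S \<and> (\<forall>i\<le>int K. x i = Some 1)"

definition joinable ::
  "((int \<Rightarrow> nat option) \<Rightarrow> int \<Rightarrow> 'b) \<Rightarrow> (int \<Rightarrow> 'b) set \<Rightarrow> (int \<Rightarrow> nat option) \<Rightarrow> (int \<Rightarrow> nat option) \<Rightarrow> bool"
  where "joinable p Y x r \<longleftrightarrow> glue 0 (p x) (p r) \<in> Y"

text \<open>For the two components these are the sets \<open>A\<close> and \<open>B\<close> with
  \<open>S = A \<inter> B\<close> up to finitely many elements. Joinability will depend on the sum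
  of both counts only, so the left count is fixed at \<open>2 * W\<close>, the smallest with the
  margin needed.\<close>

definition gaps :: "((int \<Rightarrow> nat option) \<Rightarrow> int \<Rightarrow> 'b) \<Rightarrow> (int \<Rightarrow> 'b) set \<Rightarrow> nat \<Rightarrow> nat set" where
  "gaps p Y W = {n. joinable p Y (zero_at (- int (2 * W) - 1)) (zero_at (int (n - 2 * W)))}"

text \<open>The maps \<open>p\<close> and \<open>q\<close> are the two components of a conjugacy onto a product, and \<open>g\<close> is its
  inverse; all of them have radius \<open>W\<close>.\<close>

locale star_gap_decomposition =
  fixes S :: "nat set" and Y :: "(int \<Rightarrow> 'b) set" and Z :: "(int \<Rightarrow> 'c) set"
    and p :: "(int \<Rightarrow> nat option) \<Rightarrow> int \<Rightarrow> 'b" and q :: "(int \<Rightarrow> nat option) \<Rightarrow> int \<Rightarrow> 'c"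
    and g :: "(int \<Rightarrow> 'b) \<Rightarrow> (int \<Rightarrow> 'c) \<Rightarrow> int \<Rightarrow> nat option" and W :: nat
  assumes not_periodic: "\<not> eventually_periodic S"
    and W: "0 < W"
    and p_in: "\<And>x. x \<in> star_gap S \<Longrightarrow> p x \<in> Y"
    and q_in: "\<And>x. x \<in> star_gap S \<Longrightarrow> q x \<in> Z"
    and g_in: "\<And>y z. y \<in> Y \<Longrightarrow> z \<in> Z \<Longrightarrow> g y z \<in> star_gap S"
    and g_pq: "\<And>x. x \<in> star_gap S \<Longrightarrow> g (p x) (q x) = x"
    and p_g: "\<And>y z. y \<in> Y \<Longrightarrow> z \<in> Z \<Longrightarrow> p (g y z) = y"
    and q_g: "\<And>y z. y \<in> Y \<Longrightarrow> z \<in> Z \<Longrightarrow> q (g y z) = z"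
    and p_local: "\<And>x x' i. x \<in> star_gap S \<Longrightarrow> x' \<in> star_gap S \<Longrightarrow>
      (\<And>k. i - int W \<le> k \<Longrightarrow> k \<le> i + int W \<Longrightarrow> x k = x' k) \<Longrightarrow> p x i = p x' i"
    and q_local: "\<And>x x' i. x \<in> star_gap S \<Longrightarrow> x' \<in> star_gap S \<Longrightarrow>
      (\<And>k. i - int W \<le> k \<Longrightarrow> k \<le> i + int W \<Longrightarrow> x k = x' k) \<Longrightarrow> q x i = q x' i"
    and g_local: "\<And>y y' z z' i. y \<in> Y \<Longrightarrow> y' \<in> Y \<Longrightarrow> z \<in> Z \<Longrightarrow> z' \<in> Z \<Longrightarrow>
      (\<And>k. i - int W \<le> k \<Longrightarrow> k \<le> i + int W \<Longrightarrow> y k = y' k) \<Longrightarrow>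
      (\<And>k. i - int W \<le> k \<Longrightarrow> k \<le> i + int W \<Longrightarrow> z k = z' k) \<Longrightarrow> g y z i = g y' z' i"
    and p_shift: "\<And>x n. x \<in> star_gap S \<Longrightarrow> p (shift n x) = shift n (p x)"
    and q_shift: "\<And>x n. x \<in> star_gap S \<Longrightarrow> q (shift n x) = shift n (q x)"
    and Y_shift: "\<And>y n. y \<in> Y \<Longrightarrow> shift n y \<in> Y"
    and Z_shift: "\<And>z n. z \<in> Z \<Longrightarrow> shift n z \<in> Z"
begin

text \<open>The assumptions are symmetric in the two factors, which turns every fact about
  \<open>p\<close> into one about \<open>q\<close>.\<close>

lemma swapped: "star_gap_decomposition S Z Y q p (\<lambda>z y. g y z) W"
  by unfold_locales (rule not_periodic W p_in q_in g_in g_pq p_g q_g p_shift q_shift Y_shift Z_shift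
    p_local q_local g_local; assumption)+

lemma infinite: "infinite S"
  using not_periodic finite_eventually_periodic by blast

lemmas one_in = all_ones_in_star_gap[OF infinite]
lemmas zero_in = zero_at_in_star_gap[OF infinite]

lemma p_one:
  assumes "x \<in> star_gap S" "\<And>k. i - int W \<le> k \<Longrightarrow> k \<le> i + int W \<Longrightarrow> x k = Some 1"
  shows "p x i = p all_ones i"
  by (rule p_local[OF assms(1) one_in]) (rule assms(2))

text \<open>Both points are ones near the seam, so on a window of radius \<open>W\<close> around any
  cell the glued point coincides with the point on the side of that cell.\<close>

lemma p_glue:
  assumes x: "left_point S (2 * W) x" and r: "right_point S (2 * W) r" and "glue 0 x r \<in> star_gap S"
  shows "p (glue 0 x r) = glue 0 (p x) (p r)"
proof
  fix i
  have xX: "x \<in> star_gap S" "r \<in> star_gap S"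
    using x r by (simp_all add: left_point_def right_point_def)
  have agree: "x k = r k" if "- int W \<le> k" "k \<le> int W" for k
    using x r that by (simp add: left_point_def right_point_def)
  show "p (glue 0 x r) i = glue 0 (p x) (p r) i"
  proof (cases "i < 0")
    case True
    have "p (glue 0 x r) i = p x i"
      by (rule p_local[OF assms(3) xX(1)]) (use True agree in \<open>simp add: glue_def\<close>)
    then show ?thesis using True by (simp add: glue_def)
  next
    case False
    have "p (glue 0 x r) i = p r i"
      by (rule p_local[OF assms(3) xX(2)]) (use False agree in \<open>simp add: glue_def\<close>)
    then show ?thesis using False by (simp add: glue_def)
  qed
qed

lemma p_agree:
  assumes x: "left_point S (2 * W) x" and r: "right_point S (2 * W) r" and k: "- int W \<le> k" "k \<le> int W"
  shows "p x k = p r k"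
proof -
  have "p x k = p all_ones k"
    by (rule p_one) (use x k in \<open>simp_all add: left_point_def\<close>)
  moreover have "p r k = p all_ones k"
    by (rule p_one) (use r k in \<open>simp_all add: right_point_def\<close>)
  ultimately show ?thesis by simp
qed

lemma right_point_mono: "right_point S K x \<Longrightarrow> L \<le> K \<Longrightarrow> right_point S L x"
  by (simp add: right_point_def)

lemma left_point_zero_at: "K \<le> a \<Longrightarrow> left_point S K (zero_at (- int a - 1))"
  by (simp add: left_point_def zero_in) (simp add: zero_at_def)

lemma right_point_zero_at: "K < b \<Longrightarrow> right_point S K (zero_at (int b))"
  by (simp add: right_point_def zero_in) (simp add: zero_at_def)

lemma left_point_one: "left_point S K all_ones"
  by (simp add: left_point_def one_in)

lemmas q_glue = star_gap_decomposition.p_glue[OF swapped]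
lemmas q_agree = star_gap_decomposition.p_agree[OF swapped]

text \<open>Forwards, the components of the glued point are the glued components. Backwards,
  \<open>g\<close> applied to the glued components gives \<open>x\<close> on the left and
  \<open>r\<close> on the right, since the components of \<open>x\<close> and \<open>r\<close> agree
  within \<open>W\<close> of the seam.\<close>

lemma glue_iff_joinable:
  assumes x: "left_point S (2 * W) x" and r: "right_point S (2 * W) r"
  shows "glue 0 x r \<in> star_gap S \<longleftrightarrow> joinable p Y x r \<and> joinable q Z x r"
proof
  assume "glue 0 x r \<in> star_gap S"
  with p_in q_in p_glue[OF x r this] q_glue[OF x r this]
  show "joinable p Y x r \<and> joinable q Z x r" unfolding joinable_def by metis
next
  assume j: "joinable p Y x r \<and> joinable q Z x r"
  have xX: "x \<in> star_gap S" "r \<in> star_gap S"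
    using x r by (simp_all add: left_point_def right_point_def)
  let ?y = "glue 0 (p x) (p r)" and ?z = "glue 0 (q x) (q r)"
  have yz: "?y \<in> Y" "?z \<in> Z" using j by (simp_all add: joinable_def)
  note agree = p_agree[OF x r] q_agree[OF x r]
  have "g ?y ?z = glue 0 x r"
  proof
    fix i
    show "g ?y ?z i = glue 0 x r i"
    proof (cases "i < 0")
      case True
      have "g ?y ?z i = g (p x) (q x) i"
        by (rule g_local[OF yz(1) p_in[OF xX(1)] yz(2) q_in[OF xX(1)]])
          (use True agree in \<open>simp_all add: glue_def\<close>)
      then show ?thesis using True g_pq[OF xX(1)] by (simp add: glue_def)
    next
      case False
      have "g ?y ?z i = g (p r) (q r) i"
        by (rule g_local[OF yz(1) p_in[OF xX(2)] yz(2) q_in[OF xX(2)]])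
          (use False agree in \<open>simp_all add: glue_def\<close>)
      then show ?thesis using False g_pq[OF xX(2)] by (simp add: glue_def)
    qed
  qed
  then show "glue 0 x r \<in> star_gap S" using g_in[OF yz] by simp
qed

abbreviation mix :: "(int \<Rightarrow> nat option) \<Rightarrow> (int \<Rightarrow> nat option) \<Rightarrow> int \<Rightarrow> nat option" where
  "mix x x' \<equiv> g (p x) (q x')"

lemma mix_in: "x \<in> star_gap S \<Longrightarrow> x' \<in> star_gap S \<Longrightarrow> mix x x' \<in> star_gap S"
  by (intro g_in p_in q_in)

lemma p_mix: "x \<in> star_gap S \<Longrightarrow> x' \<in> star_gap S \<Longrightarrow> p (mix x x') = p x"
  by (intro p_g p_in q_in)

lemma q_mix: "x \<in> star_gap S \<Longrightarrow> x' \<in> star_gap S \<Longrightarrow> q (mix x x') = q x'"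
  by (intro q_g p_in q_in)

text \<open>Two maps of radius \<open>W\<close> are composed, so the radius is \<open>2 * W\<close>.
  This is what mixing takes off the margins, from \<open>4 * W\<close> to
  \<open>2 * W\<close>.\<close>

lemma mix_local:
  assumes "x \<in> star_gap S" "x' \<in> star_gap S" "y \<in> star_gap S" "y' \<in> star_gap S"
    and "\<And>k. i - 2 * int W \<le> k \<Longrightarrow> k \<le> i + 2 * int W \<Longrightarrow> x k = y k"
    and "\<And>k. i - 2 * int W \<le> k \<Longrightarrow> k \<le> i + 2 * int W \<Longrightarrow> x' k = y' k"
  shows "mix x x' i = mix y y' i"
proof (rule g_local)
  fix k assume k: "i - int W \<le> k" "k \<le> i + int W"
  show "p x k = p y k" by (rule p_local[OF assms(1,3)], rule assms(5)) (use k in auto)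
  show "q x' k = q y' k" by (rule q_local[OF assms(2,4)], rule assms(6)) (use k in auto)
qed (use assms in \<open>simp_all add: p_in q_in\<close>)

lemma mix_same: "x \<in> star_gap S \<Longrightarrow> mix x x = x"
  by (rule g_pq)

lemma mix_left_point:
  assumes "left_point S (4 * W) x" "left_point S (4 * W) x'"
  shows "left_point S (2 * W) (mix x x')"
proof -
  have X: "x \<in> star_gap S" "x' \<in> star_gap S" using assms by (simp_all add: left_point_def)
  have "mix x x' i = Some 1" if "i \<ge> - int (2 * W)" for i
  proof -
    have "mix x x' i = mix all_ones all_ones i"
      by (rule mix_local[OF X one_in one_in]) (use assms that in \<open>simp_all add: left_point_def\<close>)
    then show ?thesis using mix_same[OF one_in] by metis
  qed
  then show ?thesis using mix_in[OF X] by (simp add: left_point_def)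
qed

lemma mix_right_point:
  assumes "right_point S (4 * W) x" "right_point S (4 * W) x'"
  shows "right_point S (2 * W) (mix x x')"
proof -
  have X: "x \<in> star_gap S" "x' \<in> star_gap S" using assms by (simp_all add: right_point_def)
  have "mix x x' i = Some 1" if "i \<le> int (2 * W)" for i
  proof -
    have "mix x x' i = mix all_ones all_ones i"
      by (rule mix_local[OF X one_in one_in]) (use assms that in \<open>simp_all add: right_point_def\<close>)
    then show ?thesis using mix_same[OF one_in] by metis
  qed
  then show ?thesis using mix_in[OF X] by (simp add: right_point_def)
qed

lemma glue_left_counts:
  assumes "left_point S K x" "left_point S K x'" "left_counts x 0 = left_counts x' 0"
    and r: "r \<in> star_gap S" and W: "0 < K" and "glue 0 x r \<in> star_gap S"
  shows "glue 0 x' r \<in> star_gap S"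
proof -
  have "x' \<in> star_gap S" "x \<in> star_gap S" "x' (-1) = Some 1"
    using assms(1,2) W by (simp_all add: left_point_def)
  then show ?thesis
    using assms(3,6) glue_iff[OF infinite _ r, of x 0] glue_iff[OF infinite _ r, of x' 0] by simp
qed

text \<open>A right tail testing only the \<open>p\<close>-component is combined with one that the \<open>q\<close>-component is
  known to pass.\<close>

lemma joinable_left_counts_imp:
  assumes x: "left_point S (2 * W) x" and x': "left_point S (2 * W) x'"
    and c: "left_counts x 0 = {a}" "left_counts x' 0 = {a}"
    and r: "right_point S (4 * W) r" and j: "joinable p Y x r"
  shows "joinable p Y x' r"
proof -
  \<comment> \<open>\<open>a + b\<close> in \<open>S\<close> lets \<open>r'\<close> follow
    \<open>x\<close>, which gives the passed \<open>q\<close>-test; \<open>b > 4 * W\<close>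
    supplies the margin that mixing uses up.\<close>
  obtain s where s: "s \<in> S" "a + 4 * W + 1 \<le> s" using infinite_nat_ge[OF infinite] by blast
  define b where "b = s - a"
  have b: "a + b \<in> S" "4 * W < b" using s by (auto simp: b_def)
  define r' where "r' = zero_at (int b)"
  have r': "right_point S (4 * W) r'" unfolding r'_def by (rule right_point_zero_at[OF b(2)])
  have X: "x \<in> star_gap S" "r \<in> star_gap S" "r' \<in> star_gap S"
    using x r r' by (simp_all add: left_point_def right_point_def)
  have "glue 0 x r' \<in> star_gap S"
    unfolding r'_def using glue_zero_at_iff[OF infinite X(1)] c b(1) by simp
  then have jq: "joinable q Z x r'"
    using glue_iff_joinable[OF x right_point_mono[OF r']] by simp
  have m: "right_point S (2 * W) (mix r r')" by (rule mix_right_point[OF r r'])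
  then have mX: "mix r r' \<in> star_gap S" by (simp add: right_point_def)
  have "joinable p Y x (mix r r')" "joinable q Z x (mix r r')"
    using j jq p_mix[OF X(2,3)] q_mix[OF X(2,3)] by (simp_all add: joinable_def)
  then have "glue 0 x (mix r r') \<in> star_gap S" using glue_iff_joinable[OF x m] by simp
  then have "glue 0 x' (mix r r') \<in> star_gap S"
    using glue_left_counts[OF x x' _ mX] c W by simp
  then have "joinable p Y x' (mix r r')" using glue_iff_joinable[OF x' m] by simp
  then show ?thesis using p_mix[OF X(2,3)] by (simp add: joinable_def)
qed

lemma joinable_left_counts:
  assumes "left_point S (2 * W) x" "left_point S (2 * W) x'"
    and "left_counts x 0 = {a}" "left_counts x' 0 = {a}" "right_point S (4 * W) r"
  shows "joinable p Y x r \<longleftrightarrow> joinable p Y x' r"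
  using joinable_left_counts_imp[OF assms] joinable_left_counts_imp[OF assms(2,1,4,3,5)] by blast

text \<open>Up to a shift by one cell, the same two component points are cut at 1 and at 0. They
  agree at cell 0, so both cuts give the same result.\<close>

lemma joinable_step:
  assumes "2 * W \<le> a" "2 * W < b"
  shows "joinable p Y (zero_at (- int (Suc a) - 1)) (zero_at (int b)) \<longleftrightarrow>
    joinable p Y (zero_at (- int a - 1)) (zero_at (int (Suc b)))"
proof -
  let ?l = "zero_at (- int a - 1)" and ?r = "zero_at (int (Suc b))"
  have l: "left_point S (2 * W) ?l" and r: "right_point S (2 * W) ?r"
    using assms by (simp_all add: left_point_zero_at right_point_zero_at del: of_nat_Suc)
  have "p ?l 0 = p ?r 0" by (rule p_agree[OF l r]) simp_all
  then have "glue 1 (p ?l) (p ?r) = glue 0 (p ?l) (p ?r)"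
    by (auto simp: glue_def fun_eq_iff) (metis less_one order_antisym_conv zle_add1_eq_le zless_imp_add1_zle not_less add_0)
  have sh: "p (zero_at (- int (Suc a) - 1)) = shift 1 (p ?l)" "p (zero_at (int b)) = shift 1 (p ?r)"
    using p_shift[OF zero_in, of 1] by (simp_all add: shift_zero_at flip: p_shift[OF zero_in])
  have "glue 0 (shift 1 (p ?l)) (shift 1 (p ?r)) = shift 1 (glue 0 (p ?l) (p ?r))"
    using \<open>glue 1 (p ?l) (p ?r) = _\<close> shift_glue[of 1 1 "p ?l" "p ?r"] by simp
  then have "joinable p Y (zero_at (- int (Suc a) - 1)) (zero_at (int b)) \<longleftrightarrow>
      shift 1 (glue 0 (p ?l) (p ?r)) \<in> Y"
    unfolding joinable_def sh by simp
  also have "\<dots> \<longleftrightarrow> joinable p Y ?l ?r"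
    unfolding joinable_def using Y_shift[of "shift 1 (glue 0 (p ?l) (p ?r))" "-1"] Y_shift by auto
  finally show ?thesis .
qed

text \<open>\<open>joinable_step\<close> moves units from the left count to the right count until
  the left one is \<open>2 * W\<close>, as in \<open>gaps\<close>.\<close>

lemma joinable_zero_at:
  assumes "2 * W \<le> a" "2 * W < b"
  shows "joinable p Y (zero_at (- int a - 1)) (zero_at (int b)) \<longleftrightarrow> a + b \<in> gaps p Y W"
  using assms
proof (induction a arbitrary: b rule: dec_induct)
  case base
  then show ?case by (simp add: gaps_def)
next
  case (step a)
  have "joinable p Y (zero_at (- int a - 1)) (zero_at (int (Suc b))) \<longleftrightarrow> a + Suc b \<in> gaps p Y W"
    by (rule step.IH) (use step.prems in simp)
  then show ?case using joinable_step[OF step.hyps(1) step.prems] by simp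
qed

lemmas joinable_q_zero_at = star_gap_decomposition.joinable_zero_at[OF swapped]

lemma gap_iff_gaps:
  assumes "4 * W < n"
  shows "n \<in> S \<longleftrightarrow> n \<in> gaps p Y W \<and> n \<in> gaps q Z W"
proof -
  let ?l = "zero_at (- int (2 * W) - 1)" and ?r = "zero_at (int (n - 2 * W))"
  have b: "2 * W < n - 2 * W" and n: "2 * W + (n - 2 * W) = n" using assms by auto
  have l: "left_point S (2 * W) ?l" by (rule left_point_zero_at) simp
  have "glue 0 ?l ?r \<in> star_gap S \<longleftrightarrow> joinable p Y ?l ?r \<and> joinable q Z ?l ?r"
    by (rule glue_iff_joinable[OF l right_point_zero_at[OF b]])
  moreover have "glue 0 ?l ?r \<in> star_gap S \<longleftrightarrow> n \<in> S"
    using glue_zero_at_iff[OF infinite zero_in, of "- int (2 * W) - 1" "n - 2 * W"] n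
    by (simp only: left_counts_zero_at ball_simps simp_thms)
  moreover have "joinable p Y ?l ?r \<longleftrightarrow> n \<in> gaps p Y W" "joinable q Z ?l ?r \<longleftrightarrow> n \<in> gaps q Z W"
    using joinable_zero_at[OF le_refl b] joinable_q_zero_at[OF le_refl b] unfolding n by blast+
  ultimately show ?thesis by blast
qed

lemma gaps_not_both_periodic:
  "\<not> (eventually_periodic (gaps p Y W) \<and> eventually_periodic (gaps q Z W))"
  using eventually_periodic_inter[of "gaps p Y W" "gaps q Z W" "Suc (4 * W)" S] gap_iff_gaps
    not_periodic by (metis Suc_le_lessD)

lemma left_counts_ge:
  assumes x: "left_point S K x" and c: "left_counts x 0 = {c}"
  shows "K \<le> c"
proof -
  have "c \<in> left_counts x 0" using c by simp
  then obtain i where i: "i < 0" "x i = Some 0" "c = ones x (i + 1) 0"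
    unfolding left_counts_def by blast
  have one: "x k = Some 1" if "- int K \<le> k" for k using x that by (simp add: left_point_def)
  have "i < - int K" using i(2) one[of i] by (cases "i < - int K") auto
  then have "c = ones x (i + 1) (- int K) + ones x (- int K) 0"
    unfolding i(3) by (intro ones_split) auto
  moreover have "ones x (- int K) 0 = K" using ones_all[of "- int K" 0 x] one by simp
  ultimately show ?thesis by simp
qed

text \<open>The mix has the \<open>p\<close>-component of the point with \<open>a\<close> ones and
  so passes the same \<open>p\<close>-tests. If it has \<open>c\<close> ones, the translates of
  \<open>gaps p Y W\<close> by \<open>a\<close> and by \<open>c\<close> eventually agree, which
  forces \<open>c = a\<close>. Without a zero it passes all tests, and \<open>gaps p Y W\<close>
  would be cofinite.\<close>

lemma mix_zero_at_counts:
  assumes np: "\<not> eventually_periodic (gaps p Y W)"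
    and a: "4 * W \<le> a" and x: "left_point S (4 * W) x"
  shows "left_counts (mix (zero_at (- int a - 1)) x) 0 = {a}"
proof -
  let ?l = "zero_at (- int a - 1)"
  let ?t = "mix ?l x"
  have l: "left_point S (4 * W) ?l" by (rule left_point_zero_at[OF a])
  have t: "left_point S (2 * W) ?t" by (rule mix_left_point[OF l x])
  have tX: "?t \<in> star_gap S" and xX: "x \<in> star_gap S" using t x by (simp_all add: left_point_def)
  have pj: "joinable p Y ?t r = joinable p Y ?l r" for r
    using p_mix[OF zero_in xX] by (simp add: joinable_def)
  show ?thesis
  proof (rule left_counts_cases[of ?t 0])
    assume e: "left_counts ?t 0 = {}"
    have "n \<in> gaps p Y W" if n: "n \<ge> a + 2 * W + 1" for n
    proof -
      define b where "b = n - a"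
      have b: "2 * W < b" "a + b = n" using n by (auto simp: b_def)
      have "glue 0 ?t (zero_at (int b)) \<in> star_gap S"
        using glue_zero_at_iff[OF infinite tX] e by simp
      then have "joinable p Y ?l (zero_at (int b))"
        using glue_iff_joinable[OF t right_point_zero_at[OF b(1)]] pj by simp
      then show ?thesis using joinable_zero_at[of a b] a b by simp
    qed
    then have "eventually_periodic (gaps p Y W)" by (rule eventually_periodic_cofinite)
    then show ?thesis using np by blast
  next
    fix c assume c: "left_counts ?t 0 = {c}"
    have cW: "2 * W \<le> c" by (rule left_counts_ge[OF t c])
    have "a + b \<in> gaps p Y W \<longleftrightarrow> c + b \<in> gaps p Y W" if b: "b \<ge> 4 * W + 1" for b
    proof -
      have r: "right_point S (4 * W) (zero_at (int b))" using b by (intro right_point_zero_at) simp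
      have "joinable p Y ?t (zero_at (int b)) \<longleftrightarrow>
          joinable p Y (zero_at (- int c - 1)) (zero_at (int b))"
        by (rule joinable_left_counts[OF t left_point_zero_at[OF cW] c left_counts_zero_at r])
      moreover have "joinable p Y (zero_at (- int c - 1)) (zero_at (int b)) \<longleftrightarrow> c + b \<in> gaps p Y W"
        by (rule joinable_zero_at) (use b cW in auto)
      moreover have "joinable p Y ?l (zero_at (int b)) \<longleftrightarrow> a + b \<in> gaps p Y W"
        by (rule joinable_zero_at) (use b a in auto)
      ultimately show ?thesis using pj by blast
    qed
    then have "c = a" using eventually_periodicI[of "4 * W + 1" a "gaps p Y W" c] np by blast
    then show ?thesis using c by simp
  qed
qed

text \<open>Having \<open>a\<close> ones before cell 0 forces the last zero below
  \<open>- a\<close>, hence left of \<open>m\<close>, and the count can be cut at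
  \<open>m\<close>.\<close>

lemma left_counts_split:
  assumes c: "left_counts x 0 = {a}" and m: "m \<le> 0" and small: "- m \<le> int a"
  obtains c where "left_counts x m = {c}" "a = c + ones x m 0"
proof -
  have "a \<in> left_counts x 0" using c by simp
  then obtain i where i: "i < 0" "x i = Some 0" "no_zero x (i + 1) 0" "a = ones x (i + 1) 0"
    unfolding left_counts_def by blast
  have "a \<le> nat (- i - 1)" using ones_le[of x "i + 1" 0] i(4) by simp
  then have im: "i < m" using small i(1) by linarith
  have "no_zero x (i + 1) m" using i(3) no_zero_split[of "i + 1" m 0 x] im m by simp
  then have "left_counts x m = {ones x (i + 1) m}" by (rule left_counts_eqI[of i m x, OF im i(2)])
  moreover have "a = ones x (i + 1) m + ones x m 0"
    unfolding i(4) by (rule ones_split) (use im m in auto)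
  ultimately show thesis by (rule that)
qed

text \<open>\<open>?t\<close> and \<open>?u\<close> both have left count \<open>a\<close> and
  coincide left of \<open>m\<close>, so they have equally many ones between \<open>m\<close> and 0.
  There \<open>?u\<close> consists of ones, hence so does \<open>?t\<close>, which from
  \<open>m\<close> on coincides with \<open>mix all_ones x\<close>.\<close>

lemma mix_one_homoclinic:
  assumes np: "\<not> eventually_periodic (gaps p Y W)"
    and x: "left_point S (4 * W) x" and far: "\<And>i. i < - int K \<Longrightarrow> x i = Some 1"
  shows "mix all_ones x = all_ones"
proof -
  have xX: "x \<in> star_gap S" using x by (simp add: left_point_def)
  \<comment> \<open>Within \<open>2 * W\<close> of a cell left of \<open>m\<close>, the point
    \<open>x\<close> shows only ones. Within \<open>2 * W\<close> of a cell from \<open>m\<close>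
    on, the zero at \<open>- a - 1\<close> is out of sight.\<close>
  define a where "a = K + 4 * W"
  define m where "m = - int a + 2 * int W"
  have m: "m \<le> 0" "- m \<le> int a" "m + 2 * int W \<le> - int K" by (auto simp: m_def a_def)
  have a: "4 * W \<le> a" by (simp add: a_def)
  let ?l = "zero_at (- int a - 1)"
  let ?t = "mix ?l x" and ?u = "mix ?l all_ones" and ?v = "mix all_ones x"
  have tc: "left_counts ?t 0 = {a}" by (rule mix_zero_at_counts[OF np a x])
  have uc: "left_counts ?u 0 = {a}" by (rule mix_zero_at_counts[OF np a left_point_one])
  have tu: "?t i = ?u i" if "i < m" for i
    by (rule mix_local[OF zero_in xX zero_in one_in]) (use that m far in auto)
  have u1: "?u i = Some 1" if "m \<le> i" for i
  proof -
    have "?u i = mix all_ones all_ones i"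
      by (rule mix_local[OF zero_in one_in one_in one_in]) (use that in \<open>auto simp: zero_at_def m_def\<close>)
    then show ?thesis using mix_same[OF one_in] by metis
  qed
  have tv: "?t i = ?v i" if "m \<le> i" for i
    by (rule mix_local[OF zero_in xX one_in xX]) (use that in \<open>auto simp: zero_at_def m_def\<close>)
  obtain c where c: "left_counts ?t m = {c}" "a = c + ones ?t m 0"
    by (rule left_counts_split[OF tc m(1,2)])
  obtain d where d: "left_counts ?u m = {d}" "a = d + ones ?u m 0"
    by (rule left_counts_split[OF uc m(1,2)])
  have "left_counts ?t m = left_counts ?u m" by (rule left_counts_cong) (rule tu)
  then have "ones ?t m 0 = ones ?u m 0" using c d by simp
  also have "\<dots> = nat (0 - m)" by (rule ones_all) (rule u1)
  finally have t1: "?t i = Some 1" if "m \<le> i" "i < 0" for i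
    using ones_full[of ?t m 0 i] that by blast
  show ?thesis
  proof
    fix i
    consider "i < m" | "m \<le> i" "i < 0" | "0 \<le> i" by linarith
    then show "?v i = Some 1"
    proof cases
      case 1
      have "?v i = mix all_ones all_ones i"
        by (rule mix_local[OF one_in xX one_in one_in]) (use 1 m far in auto)
      then show ?thesis using mix_same[OF one_in] by metis
    next
      case 2 then show ?thesis using t1 tv[of i] by metis
    next
      case 3
      have "left_point S (2 * W) ?v" by (rule mix_left_point[OF left_point_one x])
      then show ?thesis using 3 by (simp add: left_point_def)
    qed
  qed
qed

text \<open>The value \<open>z i\<close> is decided by a window of a preimage \<open>x\<close>.
  Truncation to this window gives a point that is 1 outside a finite set; by
  \<open>mix_one_homoclinic\<close> it has the \<open>q\<close>-component of
  \<open>all_ones\<close>.\<close>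

lemma Z_singleton:
  assumes np: "\<not> eventually_periodic (gaps p Y W)"
  shows "is_singleton Z"
proof -
  have const: "z = q all_ones" if z: "z \<in> Z" for z
  proof
    fix i
    define x where "x = g (p all_ones) z"
    have x: "x \<in> star_gap S" "q x = z"
      unfolding x_def using g_in[OF p_in[OF one_in] z] q_g[OF p_in[OF one_in] z] by blast+
    define y where "y = pad (i - int W) (i + int W + 1) x"
    have y: "y \<in> star_gap S" unfolding y_def by (rule pad_in_star_gap[OF infinite x(1)])
    have "q y i = q x i" by (rule q_local[OF y x(1)]) (simp add: y_def pad_def)
    \<comment> \<open>The shift by \<open>n\<close> places the window exactly on the cells from
      \<open>- 6 * W - 1\<close> to \<open>- 4 * W - 1\<close>, just left of the margin.\<close>
    define n where "n = i + 5 * int W + 1"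
    let ?y = "shift n y"
    have y': "left_point S (4 * W) ?y"
      unfolding left_point_def
    proof (intro conjI allI impI)
      show "?y \<in> star_gap S" by (rule star_studded_shift[OF y])
      show "?y k = Some 1" if "- int (4 * W) \<le> k" for k
        using that by (simp add: y_def shift_def pad_def n_def)
    qed
    have "?y k = Some 1" if "k < - int (6 * W + 1)" for k
      using that by (simp add: y_def shift_def pad_def n_def)
    then have "mix all_ones ?y = all_ones" by (rule mix_one_homoclinic[OF np y'])
    then have "q ?y = q all_ones" using q_mix[OF one_in star_studded_shift[OF y], of n] by simp
    then have "shift n (q y) = shift n (q all_ones)"
      using q_shift[OF y, of n] q_shift[OF one_in, of n] by simp
    then have "shift (- n) (shift n (q y)) = shift (- n) (shift n (q all_ones))" by (rule arg_cong)
    then have "q y = q all_ones" by simp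
    then show "z i = q all_ones i" using \<open>q y i = q x i\<close> x(2) by simp
  qed
  moreover have "q all_ones \<in> Z" by (rule q_in[OF one_in])
  ultimately show ?thesis unfolding is_singleton_def by blast
qed

lemma singleton_factor: "is_singleton Y \<or> is_singleton Z"
  using gaps_not_both_periodic Z_singleton star_gap_decomposition.Z_singleton[OF swapped] by blast

end

section \<open>Locality of the inverse of a conjugacy\<close>

lemma openin_full_shift_square_local:
  assumes J: "finite J" and Q: "\<And>x x' y y'. (\<And>j. j \<in> J \<Longrightarrow> x j = y j) \<Longrightarrow>
    (\<And>j. j \<in> J \<Longrightarrow> x' j = y' j) \<Longrightarrow> Q x x' \<Longrightarrow> Q y y'"
  shows "openin (prod_topology (full_shift A) (full_shift A))
    {(x, x'). (\<forall>i. x i \<in> A) \<and> (\<forall>i. x' i \<in> A) \<and> Q x x'}"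
  unfolding openin_prod_topology_alt
proof (intro allI impI)
  fix x x' assume xx: "(x, x') \<in> {(x, x'). (\<forall>i. x i \<in> A) \<and> (\<forall>i. x' i \<in> A) \<and> Q x x'}"
  let ?U = "\<lambda>x. {y. (\<forall>i. y i \<in> A) \<and> (\<forall>j\<in>J. x j = y j)}"
  have op: "openin (full_shift A) (?U x)" for x
    by (rule openin_full_shift_local[OF J]) simp
  have "?U x \<times> ?U x' \<subseteq> {(x, x'). (\<forall>i. x i \<in> A) \<and> (\<forall>i. x' i \<in> A) \<and> Q x x'}"
  proof
    fix w assume "w \<in> ?U x \<times> ?U x'"
    then obtain y y' where w: "w = (y, y')" "\<forall>i. y i \<in> A" "\<forall>i. y' i \<in> A"
      "\<And>j. j \<in> J \<Longrightarrow> x j = y j" "\<And>j. j \<in> J \<Longrightarrow> x' j = y' j" by auto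
    have "Q x x'" using xx by simp
    have "Q y y'" by (rule Q[where x = x and x' = x']; (rule w(4,5) \<open>Q x x'\<close>)?)
    then show "w \<in> {(x, x'). (\<forall>i. x i \<in> A) \<and> (\<forall>i. x' i \<in> A) \<and> Q x x'}" using w by simp
  qed
  moreover have "x \<in> ?U x" "x' \<in> ?U x'" using xx by auto
  ultimately show "\<exists>U V. openin (full_shift A) U \<and> openin (full_shift A) V \<and> x \<in> U \<and> x' \<in> V \<and>
      U \<times> V \<subseteq> {(x, x'). (\<forall>i. x i \<in> A) \<and> (\<forall>i. x' i \<in> A) \<and> Q x x'}"
    by (intro exI[of _ "?U x"] exI[of _ "?U x'"] conjI op)
qed

lemma compact_space_full_shift: "finite A \<Longrightarrow> compact_space (full_shift A)"
  unfolding full_shift_def by (simp add: compact_space_product_topology compact_space_discrete_topology)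

text \<open>Compactness: the sets \<open>C V\<close> of pairs that differ at 0 but have images
  agreeing up to distance \<open>V\<close> are closed and decreasing. A pair in all of them would
  contradict injectivity, so some \<open>C V\<close> is empty.\<close>

lemma injective_code_inverse_local:
  assumes X: "subshift A X" and inj: "inj_on F X"
    and F: "\<And>x i. x \<in> X \<Longrightarrow> F x i = f (word_at x (i + m) n)"
  obtains V :: nat where "\<And>x x'. x \<in> X \<Longrightarrow> x' \<in> X \<Longrightarrow>
    (\<And>k. - int V \<le> k \<Longrightarrow> k \<le> int V \<Longrightarrow> F x k = F x' k) \<Longrightarrow> x 0 = x' 0"
proof -
  let ?T = "full_shift A" and ?G = "\<lambda>x i. f (word_at x (i + m) n)"
  define C where "C V = {(x, x'). x \<in> X \<and> x' \<in> X \<and> x 0 \<noteq> x' 0 \<and>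
    (\<forall>k. - int V \<le> k \<longrightarrow> k \<le> int V \<longrightarrow> ?G x k = ?G x' k)}" for V :: nat
  have cl: "closedin ?T X" and fin: "finite A" using X by (simp_all add: subshift_def)
  have range: "x i \<in> A" if "x \<in> X" for x i using subshift_range[OF X that] .
  have compact: "compact_space (prod_topology ?T ?T)"
    by (simp add: compact_space_prod_topology compact_space_full_shift[OF fin])
  have closed: "closedin (prod_topology ?T ?T) (C V)" for V
  proof -
    \<comment> \<open>Cell 0 and all cells that the code reads for the positions from
      \<open>- V\<close> to \<open>V\<close>.\<close>
    let ?J = "insert 0 {m - int V..<m + int V + int n}"
    let ?Q = "\<lambda>x x'. x 0 = x' 0 \<or> (\<exists>k. - int V \<le> k \<and> k \<le> int V \<and> ?G x k \<noteq> ?G x' k)"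
    let ?O = "{(x, x'). (\<forall>i. x i \<in> A) \<and> (\<forall>i. x' i \<in> A) \<and> ?Q x x'}"
    have "openin (prod_topology ?T ?T) ?O"
    proof (rule openin_full_shift_square_local[of ?J])
      fix x x' y y' :: "int \<Rightarrow> 'a"
      assume e: "\<And>j. j \<in> ?J \<Longrightarrow> x j = y j" "\<And>j. j \<in> ?J \<Longrightarrow> x' j = y' j" and Q: "?Q x x'"
      have "?G x k = ?G y k" "?G x' k = ?G y' k" if "- int V \<le> k" "k \<le> int V" for k
        using that by (auto intro!: arg_cong[where f = f] word_at_cong e)
      moreover have "x 0 = y 0" "x' 0 = y' 0" using e[of 0] by simp_all
      ultimately show "?Q y y'" using Q by metis
    qed simp
    then have "closedin (prod_topology ?T ?T) (X \<times> X - ?O)"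
      using cl by (intro closedin_diff) (simp_all add: closedin_prod_Times_iff)
    moreover have "X \<times> X - ?O = C V" unfolding C_def using range by auto
    ultimately show ?thesis by simp
  qed
  have dec: "decseq C" unfolding decseq_def C_def by force
  have "\<exists>V. C V = {}"
  proof (rule ccontr)
    assume "\<not> ?thesis"
    then have "(\<Inter>V. C V) \<noteq> {}"
      using compact_space_imp_nest[OF compact closed _ dec] by blast
    then obtain x x' where xx: "\<And>V. (x, x') \<in> C V" by auto
    then have X: "x \<in> X" "x' \<in> X" "x 0 \<noteq> x' 0" using xx[of 0] by (simp_all add: C_def)
    have "F x k = F x' k" for k
      using xx[of "nat \<bar>k\<bar>"] F[OF X(1)] F[OF X(2)] by (simp add: C_def)
    then have "F x = F x'" by (rule ext)
    then have "x = x'" using inj_onD[OF inj] X by blast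
    then show False using X(3) by simp
  qed
  then obtain V where V: "C V = {}" by blast
  show thesis
  proof (rule that)
    fix x x' assume x: "x \<in> X" "x' \<in> X" and e: "\<And>k. - int V \<le> k \<Longrightarrow> k \<le> int V \<Longrightarrow> F x k = F x' k"
    then have "(x, x') \<notin> C V" using V by simp
    then show "x 0 = x' 0" using x e F[OF x(1)] F[OF x(2)] unfolding C_def by auto
  qed
qed

text \<open>The coordinates of the conjugacy and its inverse form a
  \<open>star_gap_decomposition\<close>; what has to be supplied is a common radius and commutation
  with shifts.\<close>

lemma direct_prime_star_gap:
  assumes np: "\<not> eventually_periodic S"
  shows "direct_prime (star_gap S)"
  unfolding direct_prime_def
proof (intro allI impI)
  fix B C :: "nat set" and Y Z
  let ?X = "star_gap S"
  assume Y: "subshift B Y" and Z: "subshift C Z" and conj: "conjugate ?X (product_shift Y Z)"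
  have inf: "infinite S" using np finite_eventually_periodic by blast
  obtain F m a f where bij: "bij_betw F ?X (product_shift Y Z)" and ma: "m \<le> a"
    and F: "\<And>x i. x \<in> ?X \<Longrightarrow> F x i = f (word_at x (i + m) (nat (a - m + 1)))"
    using conj unfolding conjugate_def sliding_block_code_def by metis
  have inj: "inj_on F ?X" using bij by (simp add: bij_betw_def)
  obtain V :: nat where V: "\<And>x x'. x \<in> ?X \<Longrightarrow> x' \<in> ?X \<Longrightarrow>
      (\<And>k. - int V \<le> k \<Longrightarrow> k \<le> int V \<Longrightarrow> F x k = F x' k) \<Longrightarrow> x 0 = x' 0"
    using injective_code_inverse_local[OF subshift_star_gap[OF inf] inj F] by blast
  \<comment> \<open>Covers the window from \<open>m\<close> to \<open>a\<close> of the code and the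
    radius \<open>V\<close> of its inverse; \<open>Suc\<close> makes it positive.\<close>
  define W where "W = Suc (V + nat \<bar>m\<bar> + nat \<bar>a\<bar>)"
  define p where "p x = (\<lambda>i. fst (F x i))" for x
  define q where "q x = (\<lambda>i. snd (F x i))" for x
  define g where "g y z = inv_into ?X F (\<lambda>i. (y i, z i))" for y z
  have Fpq: "F x = (\<lambda>i. (p x i, q x i))" for x by (simp add: p_def q_def)
  have F_local: "F x i = F x' i" if "x \<in> ?X" "x' \<in> ?X"
    "\<And>k. i - int W \<le> k \<Longrightarrow> k \<le> i + int W \<Longrightarrow> x k = x' k" for x x' i
    unfolding F[OF that(1)] F[OF that(2)]
    by (rule arg_cong[where f = f], rule word_at_cong, rule that(3)) (use ma in \<open>auto simp: W_def\<close>)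
  have F_shift: "F (shift n x) = shift n (F x)" if "x \<in> ?X" for n x
  proof
    fix i
    show "F (shift n x) i = shift n (F x) i"
      unfolding F[OF star_studded_shift[OF that]] by (simp add: shift_def[of n "F x"] F[OF that] add_ac)
  qed
  have pair: "(\<lambda>i. (y i, z i)) \<in> F ` ?X" if "y \<in> Y" "z \<in> Z" for y z
    using bij that unfolding bij_betw_def product_shift_def by blast
  have Fg: "F (g y z) = (\<lambda>i. (y i, z i))" and g_in: "g y z \<in> ?X" if "y \<in> Y" "z \<in> Z" for y z
    unfolding g_def by (rule f_inv_into_f[OF pair[OF that]], rule inv_into_into[OF pair[OF that]])
  have pq_in: "p x \<in> Y" "q x \<in> Z" if x: "x \<in> ?X" for x
  proof -
    have "F x \<in> product_shift Y Z" using bij x by (rule bij_betw_apply)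
    then obtain y z where yz: "F x = (\<lambda>i. (y i, z i))" "y \<in> Y" "z \<in> Z"
      unfolding product_shift_def by blast
    have "p x = y" "q x = z" unfolding p_def q_def yz(1) by simp_all
    then show "p x \<in> Y" "q x \<in> Z" using yz by simp_all
  qed
  have subshift_shift: "shift n y \<in> U" if U: "subshift D U" and y: "y \<in> U" for n y D and U :: "(int \<Rightarrow> nat) set"
  proof -
    have im: "shift 1 ` U = U" using U by (simp add: subshift_def)
    have up: "shift 1 v \<in> U" if "v \<in> U" for v using im that by blast
    have down: "shift (-1) v \<in> U" if "v \<in> U" for v
    proof -
      have "v \<in> shift 1 ` U" using im that by simp
      then show ?thesis by auto
    qed
    show ?thesis
    proof (induction n rule: int_induct[of _ 0])
      case base then show ?case using y by simp
    next
      case (step1 i) then show ?case using up[of "shift i y"] by (simp add: add.commute)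
    next
      case (step2 i) then show ?case using down[of "shift i y"] by simp
    qed
  qed
  interpret star_gap_decomposition S Y Z p q g W
  proof
    show "\<not> eventually_periodic S" by (rule np)
    show "0 < W" by (simp add: W_def)
    show "p x \<in> Y" "q x \<in> Z" if "x \<in> ?X" for x using pq_in[OF that] .
    show "g y z \<in> ?X" if "y \<in> Y" "z \<in> Z" for y z by (rule g_in[OF that])
    show "g (p x) (q x) = x" if "x \<in> ?X" for x
      unfolding g_def Fpq[symmetric] by (rule inv_into_f_f[OF inj that])
    show "p (g y z) = y" "q (g y z) = z" if "y \<in> Y" "z \<in> Z" for y z
      using Fg[OF that] by (simp_all add: p_def q_def)
    show "p x i = p x' i" "q x i = q x' i" if "x \<in> ?X" "x' \<in> ?X"
      "\<And>k. i - int W \<le> k \<Longrightarrow> k \<le> i + int W \<Longrightarrow> x k = x' k" for x x' i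
      using F_local[OF that] by (simp_all add: p_def q_def)
    show "p (shift n x) = shift n (p x)" "q (shift n x) = shift n (q x)" if "x \<in> ?X" for x n
      unfolding p_def q_def F_shift[OF that] by (simp_all add: shift_def)
    show "shift n y \<in> Y" if "y \<in> Y" for y n by (rule subshift_shift[OF Y that])
    show "shift n z \<in> Z" if "z \<in> Z" for z n by (rule subshift_shift[OF Z that])
    fix y y' z z' i
    assume y: "y \<in> Y" "y' \<in> Y" and z: "z \<in> Z" "z' \<in> Z"
      and e: "\<And>k. i - int W \<le> k \<Longrightarrow> k \<le> i + int W \<Longrightarrow> y k = y' k"
        "\<And>k. i - int W \<le> k \<Longrightarrow> k \<le> i + int W \<Longrightarrow> z k = z' k"
    let ?x = "g y z" and ?x' = "g y' z'"
    have x: "?x \<in> ?X" "?x' \<in> ?X" using g_in y z by blast+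
    \<comment> \<open>\<open>V\<close> controls the inverse at the origin only, so cell
      \<open>i\<close> is moved there.\<close>
    have "shift i ?x 0 = shift i ?x' 0"
    proof (rule V[OF star_studded_shift[OF x(1)] star_studded_shift[OF x(2)]])
      fix k assume "- int V \<le> k" "k \<le> int V"
      then have "i - int W \<le> k + i" "k + i \<le> i + int W" by (auto simp: W_def)
      then have "y (k + i) = y' (k + i)" "z (k + i) = z' (k + i)" using e by blast+
      then show "F (shift i ?x) k = F (shift i ?x') k"
        unfolding F_shift[OF x(1)] F_shift[OF x(2)] Fg[OF y(1) z(1)] Fg[OF y(2) z(2)]
        by (simp add: shift_def)
    qed
    then show "g y z i = g y' z' i" by (simp add: shift_def)
  qed
  show "is_singleton Y \<or> is_singleton Z" by (rule singleton_factor)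
qed

theorem proposition6p11:
  fixes S :: "nat set" and X :: "(int \<Rightarrow> nat option) set"
  defines "X \<equiv> star_studded {0, 1} (gap_shift S)"
  assumes "S \<noteq> {}" and "\<not> sofic (gap_shift S)"
  shows "subshift (star_alphabet {0, 1}) X \<and> \<not> sofic X \<and> synchronized X \<and> direct_prime X \<and>
    (\<exists>F. reversible_ca X F \<and> all_directions_sensitive X F)"
proof -
  \<comment> \<open>Non-soficity enters in this arithmetic form only.\<close>
  have np: "\<not> eventually_periodic S" using assms(3) eventually_periodic_sofic by blast
  then have inf: "infinite S" using finite_eventually_periodic by blast
  show ?thesis
    unfolding X_def synchronized_def
    using subshift_star_gap[OF inf] not_sofic_star_gap[OF np] transitive_star_gap[OF inf]
      synchronizing_star_gap[OF inf] direct_prime_star_gap[OF np] reversible_move_stars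
      all_directions_sensitive_move_stars[OF inf] by blast
qed

end
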